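(* Let the assumptions (A1), (A2) hold, and let $y_{n,\mathrm{w}}\in\mathcal{D}^1([0,T]\times\Omega;\mathbb{R}^d)$ for all $\mathrm{w}\in\mathbb{R}^N$, $n\in\mathbb{N}$. Moreover, assume that exact Lévy bridge simulation is possible, i.e. the process $\tilde L_n$ entering the approximated loss $\mathcal{L}_n$ is the exact Lévy bridge. Then there exists $\gamma\in(0,+\infty)$ such that for all $\mathrm{w}^*\in\mathbb{R}^N$, $n\in\mathbb{N}$ $$\|y_{n,\mathrm{w}^*}-Y\|_1\leq \gamma\Bigl(\inf_{\mathrm{w}\in\mathbb{R}^N}\|y_{n,\mathrm{w}}-Y\|_1+\bigl(\mathcal{L}_n(\mathrm{w}^* )-\inf_{\mathrm{w}\in\mathbb{R}^N}\mathcal{L}_n(\mathrm{w})\bigr)^{1/2}\Bigr),$$ and, if $\mathrm{w}^*\in\operatorname{argmin}_{\mathrm{w}\in\mathbb{R}^N}\mathcal{L}_n(\mathrm{w})$, then $$\|y_{n,\mathrm{w}^*}-Y\|_1\leq \gamma\inf_{\mathrm{w}\in\mathbb{R}^N}\|y_{n,\mathrm{w}}-Y\|_1.$$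
   Context: Let $T>0$, $d,m\in\mathbb{N}$, $x_0\in\mathbb{R}^d$, $\sigma\in\mathbb{R}^{d\times m}$, $a:[0,T]\times\mathbb{R}^d\to\mathbb{R}^d$. $\|\cdot\|$ is the Euclidean norm for vectors and the Frobenius norm for matrices. $(\Omega,\mathcal{F},\mathbb{P})$ is a complete probability space with a filtration $(\mathcal{F}_t)_{t\ge0}$ satisfying the usual conditions, $\mathcal{F}_\infty=\sigma(\bigcup_{t\ge 0}\mathcal{F}_t)$, and $L=(L(t))_{t\in[0,T]}$ is an $m$-dimensional (càdlàg) Lévy process with respect to $(\mathcal{F}_t)_{t\ge0}$. Assumptions: (A1) $a\in C([0,T]\times\mathbb{R}^d;\mathbb{R}^d)$. (A2) There is $L_a\in[0,+\infty)$ with $\|a(t,y_1)-a(t,y_2)\|\le L_a\|y_1-y_2\|$ for all $t\in[0,T]$, $y_1,y_2\in\mathbb{R}^d$. Set $f(t,y,w)=a(t,y+\sigma w)$ for $(t,y,w)\in[0,T]\times\mathbb{R}^d\times\mathbb{R}^m$. $Y=(Y(t))_{t\in[0,T]}$ is the unique adapted continuous process solving the random ODE $$\mathbb{P}\bigl(\forall_{t\in[0,T)}\ Y'(t)=f(t,Y(t),L(t)),\ Y(0)=x_0\bigr)=1,$$ where $Y'(t)$ is the right-hand derivative for $t\in[0,T)$ and $Y'(T):=Y'(T-)$ (equivalently $Y=X-\sigma L$, where $X$ is the unique strong solution of $dX(t)=a(t,X(t))dt+\sigma dL(t)$, $X(0)=x_0$). $\mathcal{D}^1([0,T]\times\Omega;\mathbb{R}^d)$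 is the space of $\mathbb{R}^d$-valued $(\mathcal{F}_t)$-adapted processes $y=(y(t))_{t\in[0,T]}$ with a.s. continuous trajectories, having an $(\mathcal{F}_t)$-adapted càdlàg derivative process $y'$ (as for $Y$, derivatives are right-hand derivatives on $[0,T)$), with finite norm $$\|y\|_1=\Bigl(\mathbb{E}\bigl[\sup_{0\le t\le T}\|y(t)\|^2\bigr]\Bigr)^{1/2}+\Bigl(\mathbb{E}\int_0^T\|y'(t)\|^2dt\Bigr)^{1/2}.$$ For each $n\in\mathbb{N}$ let $\Delta_n=\{0=t_0<t_1<\dots<t_n=T\}$ and $\bar L_{\Delta_n}=\{L(t_1),\dots,L(t_n)\}$, viewed as an element of $\mathbb{R}^{m\times n}$. Let $\mathcal{N}:\mathbb{R}^N\times[0,T]\times\mathbb{R}^{m\times n}\to\mathbb{R}^d$ be a feedforward artificial neural network with parameter (weight) vector $\mathrm{w}\in\mathbb{R}^N$ (its regularity being that required by the membership $y_{n,\mathrm{w}}\in\mathcal{D}^1$ assumed in the claim; its dependence on $n$ is suppressed in the notation). Set $y_{n,\mathrm{w}}(t,\omega)=\mathcal{N}(\mathrm{w},t,\bar L_{\Delta_n}(\omega))$. Let $\tau\sim U(0,T)$ be a random variable on $(\Omega,\mathcal{F},\mathbb{P})$ independent of $\mathcal{F}_\infty$. The exact Lévy bridge is the process $(\tilde L_n(t))_{t\in[0,T]}$ for which $\tilde L_n(t)$ is a sample drawn from the conditional law of $L(t)$ given $\sigma(\bar L_{\Delta_n})$, so that $\tilde L_n(t)$ and $L(t)$ have the same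 conditional law given $\sigma(\bar L_{\Delta_n})$; $\tau$ is independent of $(L,\tilde L_n)$. The approximated loss function is $$\mathcal{L}_n(\mathrm{w})=\mathbb{E}\Bigl[\|\mathcal{N}(\mathrm{w},0,\bar L_{\Delta_n})-x_0\|^2+T\cdot\Bigl\|\tfrac{\partial}{\partial t}\mathcal{N}(\mathrm{w},t,\bar L_{\Delta_n})\big|_{t=\tau}-f\bigl(\tau,\mathcal{N}(\mathrm{w},\tau,\bar L_{\Delta_n}),\tilde L_n(\tau)\bigr)\Bigr\|^2\Bigr].$$ *)

theory Defs
  imports "HOL-Probability.Probability"
begin

section \<open>Filtrations and processes on \<open>[0,T]\<close>\<close>

text \<open>Only the indices \<open>t \<ge> 0\<close> of \<open>F\<close> are constrained. Completeness of \<open>M\<close> itself, the remaining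
  part of the usual conditions, is a separate hypothesis.\<close>

definition usual_filtration :: "'a measure \<Rightarrow> (real \<Rightarrow> 'a measure) \<Rightarrow> bool" where
  "usual_filtration M F \<longleftrightarrow>
     (\<forall>t\<ge>0. subalgebra M (F t)) \<and>
     (\<forall>s t. 0 \<le> s \<and> s \<le> t \<longrightarrow> sets (F s) \<subseteq> sets (F t)) \<and>
     (\<forall>t\<ge>0. (\<Inter>s\<in>{t<..}. sets (F s)) = sets (F t)) \<and>
     null_sets M \<subseteq> sets (F 0)"

definition F_infinity :: "'a measure \<Rightarrow> (real \<Rightarrow> 'a measure) \<Rightarrow> 'a measure" where
  "F_infinity M F = sigma (space M) (\<Union>t\<in>{0..}. sets (F t))"

definition adapted_on ::
  "(real \<Rightarrow> 'a measure) \<Rightarrow> real \<Rightarrow> (real \<Rightarrow> 'a \<Rightarrow> 'b::topological_space) \<Rightarrow> bool" where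
  "adapted_on F T y \<longleftrightarrow> (\<forall>t\<in>{0..T}. y t \<in> borel_measurable (F t))"

definition cadlag_on :: "real \<Rightarrow> (real \<Rightarrow> 'b::topological_space) \<Rightarrow> bool" where
  "cadlag_on T g \<longleftrightarrow>
     (\<forall>t\<in>{0..<T}. (g \<longlongrightarrow> g t) (at_right t)) \<and>
     (\<forall>t\<in>{0<..T}. \<exists>l. (g \<longlongrightarrow> l) (at_left t))"

definition levy_process ::
  "'a measure \<Rightarrow> (real \<Rightarrow> 'a measure) \<Rightarrow> real \<Rightarrow> (real \<Rightarrow> 'a \<Rightarrow> real^'m) \<Rightarrow> bool" where
  "levy_process M F T L \<longleftrightarrow>
     adapted_on F T L \<and>
     (AE \<omega> in M. L 0 \<omega> = 0) \<and>
     (\<forall>s t. 0 \<le> s \<and> s \<le> t \<and> t \<le> T \<longrightarrow>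
        prob_space.indep_set M
          (sets (vimage_algebra (space M) (\<lambda>\<omega>. L t \<omega> - L s \<omega>) borel)) (sets (F s))) \<and>
     (\<forall>s t. 0 \<le> s \<and> s \<le> t \<and> t \<le> T \<longrightarrow>
        distr M borel (\<lambda>\<omega>. L t \<omega> - L s \<omega>) = distr M borel (L (t - s))) \<and>
     (\<forall>t\<in>{0..T}. \<forall>\<epsilon>>0.
        ((\<lambda>s. measure M {\<omega>\<in>space M. norm (L s \<omega> - L t \<omega>) > \<epsilon>}) \<longlongrightarrow> 0) (at t within {0..T})) \<and>
     (AE \<omega> in M. cadlag_on T (\<lambda>t. L t \<omega>))"


section \<open>The random ODE\<close>

definition f_coeff ::
  "(real \<Rightarrow> real^'d \<Rightarrow> real^'d) \<Rightarrow> real^'m^'d \<Rightarrow> real \<Rightarrow> real^'d \<Rightarrow> real^'m \<Rightarrow> real^'d" where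
  "f_coeff a \<sigma> t y w = a t (y + \<sigma> *v w)"

definition random_ode_solution ::
  "'a measure \<Rightarrow> (real \<Rightarrow> 'a measure) \<Rightarrow> real \<Rightarrow> (real \<Rightarrow> real^'d \<Rightarrow> real^'d) \<Rightarrow> real^'m^'d \<Rightarrow> real^'d
     \<Rightarrow> (real \<Rightarrow> 'a \<Rightarrow> real^'m) \<Rightarrow> (real \<Rightarrow> 'a \<Rightarrow> real^'d) \<Rightarrow> bool" where
  "random_ode_solution M F T a \<sigma> x0 L Y \<longleftrightarrow>
     adapted_on F T Y \<and>
     (AE \<omega> in M. continuous_on {0..T} (\<lambda>t. Y t \<omega>)) \<and>
     (AE \<omega> in M. Y 0 \<omega> = x0 \<and>
        (\<forall>t\<in>{0..<T}. ((\<lambda>s. Y s \<omega>) has_vector_derivative f_coeff a \<sigma> t (Y t \<omega>) (L t \<omega>)) (at_right t)))"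


section \<open>The space \<open>D\<^sup>1\<close>\<close>

definition ennreal_sqrt :: "ennreal \<Rightarrow> ennreal" where
  "ennreal_sqrt x = (if x = \<top> then \<top> else ennreal (sqrt (enn2real x)))"

definition right_deriv :: "(real \<Rightarrow> 'b::real_normed_vector) \<Rightarrow> real \<Rightarrow> 'b" where
  "right_deriv g t = vector_derivative g (at_right t)"

text \<open>The norm takes values in \<open>[0,\<infinity>]\<close>: without moment assumptions on the driving process the
  distance between an element of \<open>D\<^sup>1\<close> and the solution of the random ODE may be infinite.\<close>

definition norm1 :: "'a measure \<Rightarrow> real \<Rightarrow> (real \<Rightarrow> 'a \<Rightarrow> 'b::real_normed_vector) \<Rightarrow> ennreal" where
  "norm1 M T y =
     ennreal_sqrt (\<integral>\<^sup>+\<omega>. (SUP t\<in>{0..T}. ennreal ((norm (y t \<omega>))\<^sup>2)) \<partial>M) +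
     ennreal_sqrt (\<integral>\<^sup>+\<omega>. (\<integral>\<^sup>+t\<in>{0..T}. ennreal ((norm (right_deriv (\<lambda>s. y s \<omega>) t))\<^sup>2) \<partial>lborel) \<partial>M)"

text \<open>The last clause on \<open>y'\<close> is the convention \<open>y'(T) = y'(T-)\<close>.\<close>

definition D1 ::
  "'a measure \<Rightarrow> (real \<Rightarrow> 'a measure) \<Rightarrow> real \<Rightarrow> (real \<Rightarrow> 'a \<Rightarrow> 'b::real_normed_vector) set" where
  "D1 M F T =
     {y. adapted_on F T y \<and>
         (AE \<omega> in M. continuous_on {0..T} (\<lambda>t. y t \<omega>)) \<and>
         (\<exists>y'. adapted_on F T y' \<and>
            (AE \<omega> in M. cadlag_on T (\<lambda>t. y' t \<omega>)) \<and>
            (AE \<omega> in M.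
               (\<forall>t\<in>{0..<T}. ((\<lambda>s. y s \<omega>) has_vector_derivative y' t \<omega>) (at_right t)) \<and>
               ((\<lambda>t. y' t \<omega>) \<longlongrightarrow> y' T \<omega>) (at_left T))) \<and>
         norm1 M T y < \<top>}"


section \<open>Feedforward networks\<close>

text \<open>A network is given by neurons \<open>0, \<dots>, n_neurons - 1\<close> in topological order. A neuron applies its
  activation function to the sum of its bias and its weighted incoming signals; an incoming signal is
  the time, a coordinate of an observation, or the output of an earlier neuron. Weights and
  biases are components of one parameter vector, located by \<open>weight_index\<close> and \<open>bias_index\<close>; layered
  networks, with or without skip connections or shared weights, are instances.\<close>

datatype 'm signal = Time_Input | Obs_Input nat 'm | Neuron nat

record ('d, 'm) ffnn =
  n_neurons :: nat
  incoming :: "nat \<Rightarrow> 'm signal set"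
  weight_index :: "nat \<Rightarrow> 'm signal \<Rightarrow> nat"
  bias_index :: "nat \<Rightarrow> nat"
  activation :: "nat \<Rightarrow> real \<Rightarrow> real"
  output_neuron :: "'d \<Rightarrow> nat"

definition feedforward :: "nat \<Rightarrow> nat \<Rightarrow> ('d, 'm::finite) ffnn \<Rightarrow> bool" where
  "feedforward n N A \<longleftrightarrow>
     (\<forall>k<n_neurons A.
        incoming A k \<subseteq> {Time_Input} \<union> {Obs_Input l i | l i. l \<in> {1..n}} \<union> Neuron ` {..<k} \<and>
        weight_index A k ` incoming A k \<subseteq> {..<N} \<and>
        bias_index A k < N \<and>
        activation A k \<in> borel_measurable borel) \<and>
     range (output_neuron A) \<subseteq> {..<n_neurons A}"

text \<open>The guard \<open>j < k\<close> serves termination only: it always holds in a feedforward network.\<close>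

function neuron_value ::
  "('d, 'm::finite) ffnn \<Rightarrow> (nat \<Rightarrow> real) \<Rightarrow> real \<Rightarrow> (nat \<Rightarrow> real^'m) \<Rightarrow> nat \<Rightarrow> real" where
  "neuron_value A w t z k =
     activation A k (w (bias_index A k) +
       (\<Sum>s\<in>incoming A k. w (weight_index A k s) *
          (case s of
             Time_Input \<Rightarrow> t
           | Obs_Input l i \<Rightarrow> z l $ i
           | Neuron j \<Rightarrow> if j < k then neuron_value A w t z j else 0)))"
  by pat_completeness auto
termination
  by (relation "Wellfounded.measure (\<lambda>(A, w, t, z, k). k)") auto

declare neuron_value.simps [simp del]

definition net_value ::
  "('d::finite, 'm::finite) ffnn \<Rightarrow> (nat \<Rightarrow> real) \<Rightarrow> real \<Rightarrow> (nat \<Rightarrow> real^'m) \<Rightarrow> real^'d" where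
  "net_value A w t z = (\<chi> i. neuron_value A w t z (output_neuron A i))"


section \<open>Observations, Levy bridge and loss\<close>

definition partition_of :: "real \<Rightarrow> nat \<Rightarrow> (nat \<Rightarrow> real) \<Rightarrow> bool" where
  "partition_of T n p \<longleftrightarrow> p 0 = 0 \<and> p n = T \<and> strict_mono_on {0..n} p"

definition obs :: "(real \<Rightarrow> 'a \<Rightarrow> real^'m) \<Rightarrow> nat \<Rightarrow> (nat \<Rightarrow> real) \<Rightarrow> 'a \<Rightarrow> nat \<Rightarrow> real^'m" where
  "obs L n p \<omega> = (\<lambda>k\<in>{1..n}. L (p k) \<omega>)"

definition obs_sigma ::
  "'a measure \<Rightarrow> (real \<Rightarrow> 'a \<Rightarrow> real^'m) \<Rightarrow> nat \<Rightarrow> (nat \<Rightarrow> real) \<Rightarrow> 'a measure" where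
  "obs_sigma M L n p = vimage_algebra (space M) (obs L n p) (\<Pi>\<^sub>M k\<in>{1..n}. borel)"

text \<open>The \<open>\<sigma>\<close>-algebra generated by \<open>(L, L')\<close>, augmented by the null sets. Independence of a random
  variable from it is the same as independence from \<open>(L, L')\<close>.\<close>

definition joint_sigma ::
  "'a measure \<Rightarrow> real \<Rightarrow> (real \<Rightarrow> 'a \<Rightarrow> real^'m) \<Rightarrow> (real \<Rightarrow> 'a \<Rightarrow> real^'m) \<Rightarrow> 'a measure" where
  "joint_sigma M T L L' =
     sigma (space M)
       (null_sets M \<union> (\<Union>s\<in>{0..T}. sets (vimage_algebra (space M) (L s) borel) \<union>
                                   sets (vimage_algebra (space M) (L' s) borel)))"

text \<open>The first clause makes \<open>L'(\<tau>)\<close> a random variable whose conditional law given \<open>\<tau> = t\<close> is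
  that of \<open>L'(t)\<close> when \<open>\<tau>\<close> is independent of \<open>(L, L')\<close>; measurability of the single \<open>L'(t)\<close> would not
  suffice for this. It holds whenever almost all paths of \<open>L'\<close> are cadlag.\<close>

definition exact_levy_bridge ::
  "'a measure \<Rightarrow> real \<Rightarrow> (real \<Rightarrow> 'a \<Rightarrow> real^'m) \<Rightarrow> nat \<Rightarrow> (nat \<Rightarrow> real)
     \<Rightarrow> (real \<Rightarrow> 'a \<Rightarrow> real^'m) \<Rightarrow> bool" where
  "exact_levy_bridge M T L n p L' \<longleftrightarrow>
     (\<exists>X. (\<lambda>(t, \<omega>). X t \<omega>) \<in> borel_measurable (restrict_space borel {0..T} \<Otimes>\<^sub>M joint_sigma M T L L') \<and>
          (AE \<omega> in M. \<forall>t\<in>{0..T}. L' t \<omega> = X t \<omega>)) \<and>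
     (\<forall>t\<in>{0..T}. \<forall>B\<in>sets borel. AE \<omega> in M.
        real_cond_exp M (obs_sigma M L n p) (\<lambda>\<omega>'. indicator B (L' t \<omega>')) \<omega> =
        real_cond_exp M (obs_sigma M L n p) (\<lambda>\<omega>'. indicator B (L t \<omega>')) \<omega>)"

definition net_process ::
  "('d::finite, 'm::finite) ffnn \<Rightarrow> (real \<Rightarrow> 'a \<Rightarrow> real^'m) \<Rightarrow> nat \<Rightarrow> (nat \<Rightarrow> real) \<Rightarrow> (nat \<Rightarrow> real)
     \<Rightarrow> real \<Rightarrow> 'a \<Rightarrow> real^'d" where
  "net_process A L n p w t \<omega> = net_value A w t (obs L n p \<omega>)"

definition loss ::
  "'a measure \<Rightarrow> real \<Rightarrow> (real \<Rightarrow> real^'d \<Rightarrow> real^'d) \<Rightarrow> real^'m^'d \<Rightarrow> real^'d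
     \<Rightarrow> (real \<Rightarrow> 'a \<Rightarrow> real^'m) \<Rightarrow> (real \<Rightarrow> 'a \<Rightarrow> real^'m) \<Rightarrow> ('a \<Rightarrow> real)
     \<Rightarrow> ('d::finite, 'm::finite) ffnn \<Rightarrow> nat \<Rightarrow> (nat \<Rightarrow> real) \<Rightarrow> (nat \<Rightarrow> real) \<Rightarrow> ennreal" where
  "loss M T a \<sigma> x0 L L' \<tau> A n p w =
     (\<integral>\<^sup>+\<omega>. ennreal (
         (norm (net_value A w 0 (obs L n p \<omega>) - x0))\<^sup>2 +
         T * (norm (right_deriv (\<lambda>t. net_value A w t (obs L n p \<omega>)) (\<tau> \<omega>) -
                    f_coeff a \<sigma> (\<tau> \<omega>) (net_value A w (\<tau> \<omega>) (obs L n p \<omega>)) (L' (\<tau> \<omega>) \<omega>)))\<^sup>2) \<partial>M)"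

end

theory Submission
  imports Defs
begin

text \<open>
  Let \<open>J(w)\<close> be the residual functional \<open>E[|y(0) - x0|\<^sup>2 + \<integral>|y' - f(t, y, L)|\<^sup>2 dt]\<close> of the network process \<open>y\<close>.
  It equals the loss: \<open>\<tau>\<close> is independent of \<open>(L, L')\<close>, and at each time \<open>t\<close> the pairs formed by the
  observations and \<open>L t\<close>, respectively \<open>L' t\<close>, have the same law because the conditional laws agree.
  On the other hand \<open>sqrt J(w)\<close> is equivalent to the norm of \<open>y - Y\<close>, with constants depending only on
  \<open>La\<close> and \<open>T\<close>: one direction is the Lipschitz condition, the other Gronwall's inequality along
  paths. Quasi-optimality follows from \<open>sqrt J(w) \<le> sqrt (J(w) - inf J) + sqrt (inf J)\<close>.
\<close>

section \<open>Gronwall's inequality for right derivatives\<close>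

text \<open>The paths of \<open>L\<close> may jump, so \<open>Y\<close> is differentiable only from
  the right and the comparison argument has to run on right derivatives. The bridge reproduces
  \<open>L\<close> at single times, jointly with the observations, but not as a path. This suffices
  because the loss looks at one random time: once \<open>\<tau>\<close> is frozen at
  \<open>t\<close>, the integrand must be a function of the observations and \<open>L t\<close>
  alone. The network derivative is therefore recomputed from the network as a limit of difference
  quotients; the derivative process supplied by \<open>D1\<close> is merely adapted, not given as a
  function of the observations.

  Freezing \<open>\<tau>\<close> and exchanging time with expectation are Fubini arguments. They
  require joint measurability, whereas adaptedness gives measurability one time at a time. Each
  process is thus replaced by a jointly measurable one that agrees with it at all times of [0,T]
  outside a null set. No moments of \<open>L\<close> are assumed, so error and loss may be infinite,
  and the estimates are made in [0,\<infinity>].\<close>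

lemma right_derivative_nonpos_imp_le:
  fixes w w' :: "real \<Rightarrow> real"
  assumes "a \<le> b" and cont: "continuous_on {a..b} w"
    and der: "\<And>t. t \<in> {a..<b} \<Longrightarrow> (w has_real_derivative w' t) (at_right t)"
    and nonpos: "\<And>t. t \<in> {a..<b} \<Longrightarrow> w' t \<le> 0"
  shows "w b \<le> w a"
proof (rule ccontr)
  assume "\<not> w b \<le> w a"
  then have "a < b" using \<open>a \<le> b\<close> by (cases "a = b") auto
  \<comment> \<open>Half the mean slope of \<open>w\<close>: the line of slope
    \<open>\<epsilon>\<close> through \<open>(a, w a)\<close> passes below \<open>(b, w b)\<close>,
    yet \<open>\<epsilon>\<close> exceeds every right derivative. The contradiction arises at the
    last point where the graph is on or below this line: just to its right the graph still rises
    more slowly than the line.\<close>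
  define \<epsilon> where "\<epsilon> = (w b - w a) / (2 * (b - a))"
  have "\<epsilon> > 0" using \<open>a < b\<close> \<open>\<not> w b \<le> w a\<close> by (simp add: \<epsilon>_def)
  define S where "S = {a..b} \<inter> (\<lambda>t. w t - \<epsilon> * (t - a)) -` {..w a}"
  have "closed S" unfolding S_def
    by (intro continuous_closed_preimage continuous_on_diff cont continuous_intros)
  moreover have "S \<subseteq> {a..b}" by (auto simp: S_def)
  ultimately have "compact S"
    by (meson bounded_closed_interval bounded_subset compact_eq_bounded_closed)
  moreover have "a \<in> S" using \<open>a < b\<close> by (auto simp: S_def)
  ultimately obtain c where c: "c \<in> S" "\<And>t. t \<in> S \<Longrightarrow> t \<le> c"
    using compact_attains_sup[of S] by blast
  have "w b - \<epsilon> * (b - a) = (w a + w b) / 2"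
    using \<open>a < b\<close> by (simp add: \<epsilon>_def field_simps)
  then have "b \<notin> S" using \<open>\<not> w b \<le> w a\<close> by (auto simp: S_def)
  then have "c \<in> {a..<b}" using c(1) by (auto simp: S_def order_le_less)
  have "((\<lambda>s. (w s - w c) / (s - c)) \<longlongrightarrow> w' c) (at_right c)"
    using der[OF \<open>c \<in> {a..<b}\<close>] by (simp add: has_field_derivative_iff)
  from order_tendstoD(2)[OF this, of \<epsilon>]
  have "eventually (\<lambda>s. (w s - w c) / (s - c) < \<epsilon>) (at_right c)"
    using nonpos[OF \<open>c \<in> {a..<b}\<close>] \<open>\<epsilon> > 0\<close> by simp
  moreover have "eventually (\<lambda>s. s \<in> {c<..<b}) (at_right c)"
    using \<open>c \<in> {a..<b}\<close> by (intro eventually_at_right_real) auto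
  ultimately have "eventually (\<lambda>s. (w s - w c) / (s - c) < \<epsilon> \<and> s \<in> {c<..<b}) (at_right c)"
    by eventually_elim auto
  then obtain s where s: "(w s - w c) / (s - c) < \<epsilon>" "s \<in> {c<..<b}"
    using eventually_happens[of _ "at_right c"] by (auto simp: trivial_limit_at_right_real)
  then have "w s - w c < \<epsilon> * (s - c)" by (simp add: divide_less_eq)
  moreover have "w c - \<epsilon> * (c - a) \<le> w a" using c(1) by (auto simp: S_def)
  ultimately have "s \<in> S" using s(2) \<open>c \<in> {a..<b}\<close> by (auto simp: S_def algebra_simps)
  then show False using c(2)[of s] s(2) by auto
qed

text \<open>Damping the squared norm by \<open>exp (- C * s)\<close> and subtracting the running
  integral of the squared residual leaves a function with nonpositive right derivative, so the
  preceding lemma applies. The damping factor is at most 1 and may be dropped in front of the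
  residual.\<close>

lemma gronwall_right_derivative:
  fixes z z' :: "real \<Rightarrow> 'b::real_inner" and r :: "real \<Rightarrow> real"
  assumes "0 \<le> K" and t: "t \<in> {0..T}" and cont: "continuous_on {0..T} z"
    and der: "\<And>s. s \<in> {0..<T} \<Longrightarrow> (z has_vector_derivative z' s) (at_right s)"
    and bound: "\<And>s. s \<in> {0..<T} \<Longrightarrow> norm (z' s) \<le> K * norm (z s) + r s"
    and r: "\<And>s. s \<in> {0..<T} \<Longrightarrow> (r \<longlongrightarrow> r s) (at_right s)"
    and int: "(\<lambda>s. (r s)\<^sup>2) integrable_on {0..T}"
  shows "(norm (z t))\<^sup>2 \<le> exp ((2 * K + 1) * T) * ((norm (z 0))\<^sup>2 + integral {0..T} (\<lambda>s. (r s)\<^sup>2))"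
proof -
  \<comment> \<open>The part \<open>2 * K\<close> absorbs the linear term of \<open>bound\<close>;
    the additional 1 pays for splitting \<open>2 * norm (z s) * r s\<close> into two
    squares.\<close>
  define C where "C = 2 * K + 1"
  have "C \<ge> 0" using \<open>0 \<le> K\<close> by (simp add: C_def)
  define P where "P = (\<lambda>s. integral {0..s} (\<lambda>s. (r s)\<^sup>2))"
  \<comment> \<open>Working with the square of the norm makes the residual enter quadratically, so that no
    Cauchy--Schwarz step is needed.\<close>
  define w where "w = (\<lambda>s. exp (- C * s) * (z s \<bullet> z s) - P s)"
  define w' where "w' = (\<lambda>s. exp (- C * s) * (2 * (z s \<bullet> z' s)) + (- C * exp (- C * s)) * (z s \<bullet> z s) - (r s)\<^sup>2)"
  \<comment> \<open>As \<open>r\<close> is continuous only from the right, the fundamental theorem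
    is used on \<open>{s..T}\<close>, where \<open>s\<close> is the left end point, and the constant
    \<open>P s\<close> is added back.\<close>
  have derP: "(P has_real_derivative (r s)\<^sup>2) (at_right s)" if s: "s \<in> {0..<T}" for s
  proof -
    have "(\<lambda>s. (r s)\<^sup>2) integrable_on {s..T}"
      using integrable_on_subinterval[OF int] s by auto
    moreover have "continuous (at s within {s..T} - {}) (\<lambda>s. (r s)\<^sup>2)"
      using r[OF s] s by (auto simp: continuous_within at_within_Icc_at_right intro!: tendsto_intros)
    ultimately have "((\<lambda>u. integral {s..u} (\<lambda>s. (r s)\<^sup>2)) has_vector_derivative (r s)\<^sup>2) (at s within ({s..T} - {}))"
      using s by (intro integral_has_vector_derivative_continuous_at) auto
    then have *: "((\<lambda>u. P s + integral {s..u} (\<lambda>s. (r s)\<^sup>2)) has_vector_derivative (r s)\<^sup>2) (at s within {s..T})"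
      by (auto intro!: derivative_eq_intros)
    have "(P has_vector_derivative (r s)\<^sup>2) (at s within {s..T})"
    proof (rule has_vector_derivative_transform[OF _ _ *])
      show "P x = P s + integral {s..x} (\<lambda>s. (r s)\<^sup>2)" if "x \<in> {s..T}" for x
      proof -
        have "(\<lambda>s. (r s)\<^sup>2) integrable_on {0..x}"
          using integrable_on_subinterval[OF int] s that by auto
        from Henstock_Kurzweil_Integration.integral_combine[OF _ _ this, of s] show ?thesis
          using that s by (simp add: P_def)
      qed
    qed (use s in auto)
    then show ?thesis
      using s by (simp add: at_within_Icc_at_right has_real_derivative_iff_has_vector_derivative)
  qed
  have "w t \<le> w 0"
  proof (rule right_derivative_nonpos_imp_le[where w = w and w' = w'])
    show "0 \<le> t" using t by simp
    have "continuous_on {0..T} P"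
      unfolding P_def by (rule indefinite_integral_continuous_1[OF int])
    then have "continuous_on {0..T} w"
      unfolding w_def by (intro continuous_intros cont)
    then show "continuous_on {0..t} w" using t by (auto intro: continuous_on_subset)
    fix s assume "s \<in> {0..<t}"
    then have s: "s \<in> {0..<T}" using t by auto
    have "((\<lambda>s. z s \<bullet> z s) has_vector_derivative (z s \<bullet> z' s + z' s \<bullet> z s)) (at_right s)"
      by (rule bounded_bilinear.has_vector_derivative[OF bounded_bilinear_inner der[OF s] der[OF s]])
    then have "((\<lambda>s. z s \<bullet> z s) has_real_derivative 2 * (z s \<bullet> z' s)) (at_right s)"
      by (simp add: has_real_derivative_iff_has_vector_derivative inner_commute)
    then show "(w has_real_derivative w' s) (at_right s)"
      unfolding w_def w'_def
      by (auto intro!: derivative_eq_intros derP[OF s])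
    have "z s \<bullet> z' s \<le> norm (z s) * norm (z' s)"
      by (rule norm_cauchy_schwarz)
    also have "\<dots> \<le> norm (z s) * (K * norm (z s) + r s)"
      by (intro mult_left_mono bound s) auto
    finally have "2 * (z s \<bullet> z' s) \<le> 2 * K * (norm (z s))\<^sup>2 + 2 * norm (z s) * r s"
      by (simp add: algebra_simps power2_eq_square)
    also have "2 * norm (z s) * r s \<le> (norm (z s))\<^sup>2 + (r s)\<^sup>2"
      using sum_squares_bound[of "norm (z s)" "r s"] by simp
    finally have "2 * (z s \<bullet> z' s) - C * (z s \<bullet> z s) \<le> (r s)\<^sup>2"
      by (simp add: C_def algebra_simps power2_norm_eq_inner)
    then have "exp (- C * s) * (2 * (z s \<bullet> z' s) - C * (z s \<bullet> z s)) \<le> exp (- C * s) * (r s)\<^sup>2"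
      by (intro mult_left_mono) auto
    also have "\<dots> \<le> 1 * (r s)\<^sup>2"
      using s \<open>C \<ge> 0\<close> by (intro mult_right_mono) auto
    finally show "w' s \<le> 0" by (simp add: w'_def algebra_simps)
  qed
  moreover have "P 0 = 0" by (simp add: P_def)
  ultimately have "exp (- C * t) * (norm (z t))\<^sup>2 \<le> (norm (z 0))\<^sup>2 + P t"
    by (simp add: w_def power2_norm_eq_inner)
  also have "P t \<le> P T"
    unfolding P_def using t
    by (intro integral_subset_le integrable_on_subinterval[OF int] int) auto
  finally have "exp (C * t) * (exp (- C * t) * (norm (z t))\<^sup>2) \<le> exp (C * t) * ((norm (z 0))\<^sup>2 + P T)"
    by (intro mult_left_mono) auto
  then have "(norm (z t))\<^sup>2 \<le> exp (C * t) * ((norm (z 0))\<^sup>2 + P T)"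
    by (simp add: exp_minus field_simps)
  also have "\<dots> \<le> exp (C * T) * ((norm (z 0))\<^sup>2 + P T)"
  proof (rule mult_right_mono)
    show "exp (C * t) \<le> exp (C * T)" using t \<open>C \<ge> 0\<close> by (simp add: mult_left_mono)
    show "0 \<le> (norm (z 0))\<^sup>2 + P T" unfolding P_def by (intro add_nonneg_nonneg integral_nonneg int) auto
  qed
  finally show ?thesis by (simp add: C_def P_def)
qed

text \<open>An infinite residual integral makes the bound trivial because the exponential factor is
  positive; otherwise the Lebesgue and gauge integrals agree. In this form the bound can be
  integrated over paths without separating finite from infinite residuals.\<close>

lemma gronwall_right_derivative_nn_integral:
  fixes z z' :: "real \<Rightarrow> 'b::real_inner" and r :: "real \<Rightarrow> real"
  assumes K: "0 \<le> K" and t: "t \<in> {0..T}" and cont: "continuous_on {0..T} z"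
    and der: "\<And>s. s \<in> {0..<T} \<Longrightarrow> (z has_vector_derivative z' s) (at_right s)"
    and bound: "\<And>s. s \<in> {0..<T} \<Longrightarrow> norm (z' s) \<le> K * norm (z s) + r s"
    and r: "\<And>s. s \<in> {0..<T} \<Longrightarrow> (r \<longlongrightarrow> r s) (at_right s)"
    and [measurable]: "r \<in> borel_measurable borel"
  shows "ennreal ((norm (z t))\<^sup>2) \<le> ennreal (exp ((2 * K + 1) * T)) *
    (ennreal ((norm (z 0))\<^sup>2) + (\<integral>\<^sup>+s\<in>{0..T}. ennreal ((r s)\<^sup>2) \<partial>lborel))"
proof (cases "(\<integral>\<^sup>+s\<in>{0..T}. ennreal ((r s)\<^sup>2) \<partial>lborel) = \<top>")
  case True
  then show ?thesis by (simp add: ennreal_mult_top)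
next
  case False
  define f where "f = (\<lambda>s. indicator {0..T} s * (r s)\<^sup>2)"
  have f: "(\<integral>\<^sup>+s\<in>{0..T}. ennreal ((r s)\<^sup>2) \<partial>lborel) = (\<integral>\<^sup>+s. ennreal (f s) \<partial>lborel)"
    by (auto intro!: nn_integral_cong simp: f_def split: split_indicator)
  have "integrable lborel f"
    using False f by (intro integrableI_nonneg) (auto simp: f_def top.not_eq_extremum)
  then have int: "set_integrable lborel {0..T} (\<lambda>s. (r s)\<^sup>2)"
    by (simp add: set_integrable_def f_def)
  have "(\<integral>\<^sup>+s. ennreal (f s) \<partial>lborel) = ennreal (integral\<^sup>L lborel f)"
    using \<open>integrable lborel f\<close> by (intro nn_integral_eq_integral) (auto simp: f_def)
  also have "integral\<^sup>L lborel f = integral {0..T} (\<lambda>s. (r s)\<^sup>2)"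
    using set_borel_integral_eq_integral(2)[OF int] by (simp add: set_lebesgue_integral_def f_def)
  finally have eq: "(\<integral>\<^sup>+s\<in>{0..T}. ennreal ((r s)\<^sup>2) \<partial>lborel) = ennreal (integral {0..T} (\<lambda>s. (r s)\<^sup>2))"
    using f by simp
  have int': "(\<lambda>s. (r s)\<^sup>2) integrable_on {0..T}"
    by (rule set_borel_integral_eq_integral(1)[OF int])
  have "(norm (z t))\<^sup>2 \<le> exp ((2 * K + 1) * T) * ((norm (z 0))\<^sup>2 + integral {0..T} (\<lambda>s. (r s)\<^sup>2))"
    by (rule gronwall_right_derivative[OF K t cont der bound r int'])
  moreover have "0 \<le> integral {0..T} (\<lambda>s. (r s)\<^sup>2)"
    by (intro integral_nonneg int') auto
  ultimately show ?thesis
    unfolding eq by (simp flip: ennreal_plus ennreal_mult)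
qed

section \<open>Joint measurability\<close>

text \<open>Grid points strictly to the right of \<open>t\<close>, so that a right-continuous path is sampled at points
  converging from the right.\<close>

lemma filterlim_right_grid:
  fixes t T :: real
  assumes "0 \<le> t" "t < T"
  shows "filterlim (\<lambda>i. max 0 (min T (real_of_int (\<lfloor>t * real (Suc i)\<rfloor> + 1) / real (Suc i)))) (at_right t) sequentially"
    (is "filterlim ?D _ _")
  unfolding filterlim_at
proof
  \<comment> \<open>The smallest multiple of \<open>1 / Suc i\<close> strictly above
    \<open>t\<close>. Floor plus one, unlike the ceiling, stays strict when \<open>t\<close> is
    itself a grid point; clipping to [0,T] keeps this because \<open>t < T\<close>.\<close>
  define q where "q i = real_of_int (\<lfloor>t * real (Suc i)\<rfloor> + 1) / real (Suc i)" for i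
  have q: "t < q i" "q i \<le> t + inverse (real (Suc i))" for i
  proof -
    define k where "k = real (Suc i)"
    have "k > 0" by (simp add: k_def)
    have "t * k < real_of_int (\<lfloor>t * k\<rfloor> + 1)" "real_of_int (\<lfloor>t * k\<rfloor> + 1) \<le> t * k + 1"
      by linarith+
    moreover have "q i * k = real_of_int (\<lfloor>t * k\<rfloor> + 1)"
      using \<open>k > 0\<close> unfolding q_def k_def[symmetric] by simp
    ultimately have "t * k < q i * k" "q i * k \<le> (t + inverse k) * k"
      using \<open>k > 0\<close> by (simp_all add: distrib_right)
    then show "t < q i" "q i \<le> t + inverse (real (Suc i))"
      using \<open>k > 0\<close> unfolding k_def[symmetric] by auto
  qed
  have lower: "t < max 0 (min T (q i))" for i
    using q(1)[of i] assms by simp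
  have upper: "max 0 (min T (q i)) \<le> t + inverse (real (Suc i))" for i
    using q[of i] assms by linarith
  show "eventually (\<lambda>i. ?D i \<in> {t<..} \<and> ?D i \<noteq> t) sequentially"
    unfolding q_def[symmetric]
    by (intro always_eventually allI conjI) (use lower in \<open>simp_all only: greaterThan_iff less_imp_neq[OF lower, THEN not_sym] simp_thms\<close>)
  show "?D \<longlonglongrightarrow> t"
    unfolding q_def[symmetric]
    by (rule tendsto_sandwich[OF always_eventually always_eventually tendsto_const LIMSEQ_inverse_real_of_nat_add])
       (intro allI less_imp_le[OF lower] upper)+
qed

text \<open>Sampling at the next grid point turns a family measurable at each time into jointly
  measurable approximations. Their limit \<open>X\<close> is measurable everywhere, and on
  right-continuous paths it recovers \<open>y\<close>; on the remaining paths its value is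
  irrelevant.\<close>

lemma right_continuous_jointly_measurable_version:
  fixes y :: "real \<Rightarrow> 'a \<Rightarrow> 'b::{banach, second_countable_topology}"
  assumes "0 < T" and y: "\<And>t. t \<in> {0..T} \<Longrightarrow> y t \<in> borel_measurable N"
  shows "\<exists>X. (\<lambda>(t, \<omega>). X t \<omega>) \<in> borel_measurable (borel \<Otimes>\<^sub>M N) \<and>
    (\<forall>\<omega>. (\<forall>t\<in>{0..<T}. ((\<lambda>s. y s \<omega>) \<longlongrightarrow> y t \<omega>) (at_right t)) \<longrightarrow> (\<forall>t\<in>{0..T}. X t \<omega> = y t \<omega>))"
proof -
  define D where "D i t = max 0 (min T (real_of_int (\<lfloor>t * real (Suc i)\<rfloor> + 1) / real (Suc i)))" for i :: nat and t
  define X where "X t \<omega> = lim (\<lambda>i. y (D i t) \<omega>)" for t \<omega>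
  have "(\<lambda>x. y (D i (fst x)) (snd x)) \<in> borel_measurable (borel \<Otimes>\<^sub>M N)" for i
  proof -
    \<comment> \<open>The sampled time depends on \<open>t\<close> only through an integer, so joint
      measurability reduces to countably many fixed times.\<close>
    have "(\<lambda>x. (\<lambda>j x. y (max 0 (min T (real_of_int (j + 1) / real (Suc i)))) (snd x)) \<lfloor>fst x * real (Suc i)\<rfloor> x)
        \<in> borel_measurable (borel \<Otimes>\<^sub>M N)"
    proof (rule measurable_compose_countable
        [where f = "\<lambda>j x. y (max 0 (min T (real_of_int (j + 1) / real (Suc i)))) (snd x)"])
      fix j :: int
      have "y (max 0 (min T (real_of_int (j + 1) / real (Suc i)))) \<in> borel_measurable N"
        by (rule y) (use \<open>0 < T\<close> in simp)
      then show "(\<lambda>x. y (max 0 (min T (real_of_int (j + 1) / real (Suc i)))) (snd x)) \<in> borel_measurable (borel \<Otimes>\<^sub>M N)"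
        by (rule measurable_compose[OF measurable_snd])
      show "(\<lambda>x. \<lfloor>fst x * real (Suc i)\<rfloor>) \<in> borel \<Otimes>\<^sub>M N \<rightarrow>\<^sub>M count_space UNIV"
        by measurable
    qed
    then show ?thesis by (simp add: D_def)
  qed
  then have "(\<lambda>x. X (fst x) (snd x)) \<in> borel_measurable (borel \<Otimes>\<^sub>M N)"
    unfolding X_def by (rule borel_measurable_lim_metric)
  then have "(\<lambda>(t, \<omega>). X t \<omega>) \<in> borel_measurable (borel \<Otimes>\<^sub>M N)"
    by (simp add: case_prod_beta)
  moreover have "X t \<omega> = y t \<omega>"
    if right: "\<forall>t\<in>{0..<T}. ((\<lambda>s. y s \<omega>) \<longlongrightarrow> y t \<omega>) (at_right t)" and t: "t \<in> {0..T}" for \<omega> t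
  proof (cases "t = T")
    case True
    \<comment> \<open>At the right end point there is no right limit to use; clipping makes the
      sampling sequence constant there.\<close>
    have "D i T = T" for i
    proof -
      have "T * real (Suc i) \<le> real_of_int (\<lfloor>T * real (Suc i)\<rfloor> + 1)" by linarith
      then have "T \<le> real_of_int (\<lfloor>T * real (Suc i)\<rfloor> + 1) / real (Suc i)"
        by (simp add: le_divide_eq)
      then show ?thesis using \<open>0 < T\<close> by (simp add: D_def)
    qed
    then show ?thesis using True by (simp add: X_def)
  next
    case False
    then have "(\<lambda>i. y (D i t) \<omega>) \<longlonglongrightarrow> y t \<omega>"
      using filterlim_compose[OF right[rule_format] filterlim_right_grid[of t T]] t by (simp add: D_def)
    then show ?thesis by (simp add: X_def limI)
  qed
  ultimately show ?thesis by blast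
qed

text \<open>A fixed sequence of difference quotients determines the derivative, so the derivative of
  a jointly measurable function can be chosen jointly measurable.\<close>

lemma right_derivative_eq_lim:
  fixes g :: "real \<Rightarrow> 'b::real_normed_vector"
  assumes "(g has_vector_derivative g') (at_right t)"
  shows "lim (\<lambda>i. real (Suc i) *\<^sub>R (g (t + 1 / real (Suc i)) - g t)) = g'"
proof (rule limI)
  have lim: "filterlim (\<lambda>i. t + 1 / real (Suc i)) (at_right t) sequentially"
    unfolding filterlim_at
    using LIMSEQ_inverse_real_of_nat_add[of t] by (simp add: inverse_eq_divide)
  have "((\<lambda>s. (1 / (s - t)) *\<^sub>R (g s - g t)) \<longlongrightarrow> g') (at_right t)"
  proof (rule Lim_transform_eventually)
    have "((\<lambda>s. (1 / norm (s - t)) *\<^sub>R (g s - (g t + (s - t) *\<^sub>R g'))) \<longlongrightarrow> 0) (at_right t)"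
      using assms by (simp add: has_vector_derivative_def has_derivative_within)
    then show "((\<lambda>s. g' + (1 / norm (s - t)) *\<^sub>R (g s - (g t + (s - t) *\<^sub>R g'))) \<longlongrightarrow> g') (at_right t)"
      using tendsto_add[OF tendsto_const[of g']] by fastforce
    show "eventually (\<lambda>s. g' + (1 / norm (s - t)) *\<^sub>R (g s - (g t + (s - t) *\<^sub>R g')) =
        (1 / (s - t)) *\<^sub>R (g s - g t)) (at_right t)"
      unfolding eventually_at_filter
      by (intro always_eventually) (auto simp: scaleR_diff_right scaleR_add_right)
  qed
  from filterlim_compose[OF this lim]
  show "(\<lambda>i. real (Suc i) *\<^sub>R (g (t + 1 / real (Suc i)) - g t)) \<longlonglongrightarrow> g'" by simp
qed

section \<open>Measurability of networks in time and observations\<close>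

lemma borel_measurable_neuron_value:
  fixes A :: "('d, 'm::finite) ffnn"
  assumes A: "feedforward n N A" and "k < n_neurons A"
  shows "(\<lambda>x. neuron_value A w (fst x) (snd x) k) \<in> borel_measurable (borel \<Otimes>\<^sub>M (\<Pi>\<^sub>M l\<in>{1..n}. borel))"
  using \<open>k < n_neurons A\<close>
proof (induction k rule: less_induct)
  case (less k)
  have [measurable]: "activation A k \<in> borel_measurable borel"
    and inc: "incoming A k \<subseteq> {Time_Input} \<union> {Obs_Input l i | l i. l \<in> {1..n}} \<union> Neuron ` {..<k}"
    using A less.prems by (auto simp: feedforward_def)
  have [measurable]: "(\<lambda>x. case s of Time_Input \<Rightarrow> fst x | Obs_Input l i \<Rightarrow> snd x l $ i
      | Neuron j \<Rightarrow> if j < k then neuron_value A w (fst x) (snd x) j else 0)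
      \<in> borel_measurable (borel \<Otimes>\<^sub>M (\<Pi>\<^sub>M l\<in>{1..n}. borel))" if s: "s \<in> incoming A k" for s
  proof (cases s)
    case Time_Input
    then show ?thesis by simp
  next
    case (Obs_Input l i)
    then have "l \<in> {1..n}" using inc s by auto
    then have proj: "(\<lambda>x. snd x l) \<in> borel_measurable (borel \<Otimes>\<^sub>M (\<Pi>\<^sub>M l\<in>{1..n}. (borel :: (real^'m) measure)))"
      by (rule measurable_compose[OF measurable_snd measurable_component_singleton])
    have "continuous_on UNIV (\<lambda>v :: real^'m. v $ i)" by (intro continuous_intros)
    from borel_measurable_continuous_on[OF this proj] show ?thesis
      unfolding Obs_Input signal.case .
  next
    case (Neuron j)
    then have "j < k" using inc s by auto
    then show ?thesis using less Neuron by simp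
  qed
  show ?case
    by (subst neuron_value.simps) measurable
qed

lemma borel_measurable_net_value:
  fixes A :: "('d::finite, 'm::finite) ffnn"
  assumes A: "feedforward n N A"
  shows "(\<lambda>x. net_value A w (fst x) (snd x)) \<in> borel_measurable (borel \<Otimes>\<^sub>M (\<Pi>\<^sub>M l\<in>{1..n}. borel))"
proof (rule borel_measurable_euclidean_space[THEN iffD2], intro ballI)
  fix b :: "real^'d" assume "b \<in> Basis"
  then obtain i where "b = axis i 1" by (auto simp: Basis_vec_def)
  moreover have "output_neuron A i < n_neurons A"
    using A rangeI[of "output_neuron A" i] unfolding feedforward_def by blast
  ultimately show "(\<lambda>x. net_value A w (fst x) (snd x) \<bullet> b) \<in> borel_measurable (borel \<Otimes>\<^sub>M (\<Pi>\<^sub>M l\<in>{1..n}. borel))"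
    using borel_measurable_neuron_value[OF A] by (simp add: net_value_def inner_axis)
qed

section \<open>Independence and conditional laws\<close>

text \<open>On a rectangle the joint law is the integral of a conditional probability over an event
  generated by \<open>Z\<close>, hence determined by the conditional law. Rectangles are stable
  under intersection and generate the product.\<close>

lemma (in prob_space) distr_pair_eq_of_cond_exp_eq:
  assumes Z: "Z \<in> measurable M S" and V: "V \<in> measurable M B" and V': "V' \<in> measurable M B"
    and ce: "\<And>E. E \<in> sets B \<Longrightarrow> AE \<omega> in M.
      real_cond_exp M (vimage_algebra (space M) Z S) (\<lambda>\<omega>. indicator E (V' \<omega>)) \<omega> =
      real_cond_exp M (vimage_algebra (space M) Z S) (\<lambda>\<omega>. indicator E (V \<omega>)) \<omega>"
  shows "distr M (S \<Otimes>\<^sub>M B) (\<lambda>\<omega>. (Z \<omega>, V' \<omega>)) = distr M (S \<Otimes>\<^sub>M B) (\<lambda>\<omega>. (Z \<omega>, V \<omega>))"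
proof -
  note [measurable] = Z V V'
  define G where "G = vimage_algebra (space M) Z S"
  have "subalgebra M G"
    unfolding subalgebra_def G_def
    using Z by (auto simp: sets_vimage_algebra2 measurable_space[OF Z] intro: measurable_sets)
  then interpret G: finite_measure_subalgebra M G
    by unfold_locales
  have rect: "emeasure M {\<omega> \<in> space M. Z \<omega> \<in> A \<and> V' \<omega> \<in> E} = emeasure M {\<omega> \<in> space M. Z \<omega> \<in> A \<and> V \<omega> \<in> E}"
    if [measurable]: "A \<in> sets S" "E \<in> sets B" for A E
  proof -
    define C where "C = Z -` A \<inter> space M"
    have C: "C \<in> sets G" unfolding C_def G_def by (rule in_vimage_algebra) fact
    have [measurable]: "C \<in> sets M" unfolding C_def by measurable
    have *: "measure M {\<omega> \<in> space M. Z \<omega> \<in> A \<and> W \<omega> \<in> E} = (\<integral>\<omega>\<in>C. real_cond_exp M G (\<lambda>\<omega>. indicator E (W \<omega>)) \<omega> \<partial>M)"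
      if [measurable]: "W \<in> measurable M B" for W
    proof -
      have int: "integrable M (\<lambda>\<omega>. indicator E (W \<omega>) :: real)"
        by (rule integrable_const_bound[of _ 1]) (auto simp: indicator_def)
      have "(\<integral>\<omega>\<in>C. real_cond_exp M G (\<lambda>\<omega>. indicator E (W \<omega>)) \<omega> \<partial>M) = (\<integral>\<omega>\<in>C. indicator E (W \<omega>) \<partial>M)"
        using G.real_cond_exp_intA[OF int C] by simp
      also have "\<dots> = (\<integral>\<omega>. indicat_real {\<omega> \<in> space M. Z \<omega> \<in> A \<and> W \<omega> \<in> E} \<omega> \<partial>M)"
        unfolding set_lebesgue_integral_def
        by (intro Bochner_Integration.integral_cong) (auto simp: C_def indicator_def)
      also have "\<dots> = measure M {\<omega> \<in> space M. Z \<omega> \<in> A \<and> W \<omega> \<in> E}"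
        by (simp add: Int_absorb2 subset_eq)
      finally show ?thesis ..
    qed
    have "(\<integral>\<omega>\<in>C. real_cond_exp M G (\<lambda>\<omega>. indicator E (V' \<omega>)) \<omega> \<partial>M) = (\<integral>\<omega>\<in>C. real_cond_exp M G (\<lambda>\<omega>. indicator E (V \<omega>)) \<omega> \<partial>M)"
      using ce[OF \<open>E \<in> sets B\<close>] unfolding set_lebesgue_integral_def G_def[symmetric]
      by (intro integral_cong_AE) auto
    then show ?thesis
      using *[OF V] *[OF V'] by (simp add: emeasure_eq_measure)
  qed
  show ?thesis
  proof (rule measure_eqI_generator_eq[OF Int_stable_pair_measure_generator[of S B]])
    show "{a \<times> b |a b. a \<in> sets S \<and> b \<in> sets B} \<subseteq> Pow (space S \<times> space B)"
      by (rule pair_measure_closed)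
    show "sets (distr M (S \<Otimes>\<^sub>M B) (\<lambda>\<omega>. (Z \<omega>, W \<omega>))) = sigma_sets (space S \<times> space B) {a \<times> b |a b. a \<in> sets S \<and> b \<in> sets B}"
      for W by (simp add: sets_pair_measure)
    then show "sets (distr M (S \<Otimes>\<^sub>M B) (\<lambda>\<omega>. (Z \<omega>, V \<omega>))) = sigma_sets (space S \<times> space B) {a \<times> b |a b. a \<in> sets S \<and> b \<in> sets B}" .
    show "range (\<lambda>_::nat. space S \<times> space B) \<subseteq> {a \<times> b |a b. a \<in> sets S \<and> b \<in> sets B}"
      by auto
    show "(\<Union>i::nat. space S \<times> space B) = space S \<times> space B" by simp
    show "emeasure (distr M (S \<Otimes>\<^sub>M B) (\<lambda>\<omega>. (Z \<omega>, V' \<omega>))) (space S \<times> space B) \<noteq> \<infinity>" for i :: nat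
      by (subst emeasure_distr) (auto simp: emeasure_eq_measure)
    fix X assume "X \<in> {a \<times> b |a b. a \<in> sets S \<and> b \<in> sets B}"
    then obtain A E where X: "X = A \<times> E" and [measurable]: "A \<in> sets S" "E \<in> sets B" by blast
    have *: "emeasure (distr M (S \<Otimes>\<^sub>M B) (\<lambda>\<omega>. (Z \<omega>, W \<omega>))) X = emeasure M {\<omega> \<in> space M. Z \<omega> \<in> A \<and> W \<omega> \<in> E}"
      if [measurable]: "W \<in> measurable M B" for W
      unfolding X by (subst emeasure_distr) (auto intro!: arg_cong[where f = "emeasure M"])
    show "emeasure (distr M (S \<Otimes>\<^sub>M B) (\<lambda>\<omega>. (Z \<omega>, V' \<omega>))) X = emeasure (distr M (S \<Otimes>\<^sub>M B) (\<lambda>\<omega>. (Z \<omega>, V \<omega>))) X"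
      using rect[of A E] *[OF V] *[OF V'] by simp
  qed
qed

text \<open>The freezing lemma: independence makes the law of the pair of \<open>\<tau>\<close> and
  the identity into \<open>G\<close> a product measure, and Tonelli does the rest.\<close>

lemma (in prob_space) nn_integral_indep_time:
  fixes \<tau> :: "'a \<Rightarrow> 't"
  assumes \<tau>: "\<tau> \<in> measurable M S" and G: "space G = space M"
    and indep: "indep_set (sets (vimage_algebra (space M) \<tau> S)) (sets G)"
    and k: "(\<lambda>(t, \<omega>). k t \<omega>) \<in> borel_measurable (S \<Otimes>\<^sub>M G)"
  shows "(\<integral>\<^sup>+\<omega>. k (\<tau> \<omega>) \<omega> \<partial>M) = (\<integral>\<^sup>+t. (\<integral>\<^sup>+\<omega>. k t \<omega> \<partial>M) \<partial>distr M S \<tau>)"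
proof -
  have GM: "sets G \<subseteq> sets M" using indep_setD_ev2[OF indep] .
  have id: "(\<lambda>\<omega>. \<omega>) \<in> measurable M G"
    using GM G by (auto simp: measurable_def)
  note [measurable] = \<tau> id k
  \<comment> \<open>The restriction of \<open>M\<close> to \<open>G\<close>, written as an image
    measure under the identity.\<close>
  define P where "P = distr M G (\<lambda>\<omega>. \<omega>)"
  interpret P: prob_space P unfolding P_def by (rule prob_space_distr) fact
  interpret Q: prob_space "distr M S \<tau>" by (rule prob_space_distr) fact
  have "distr M S \<tau> \<Otimes>\<^sub>M P = distr M (S \<Otimes>\<^sub>M G) (\<lambda>\<omega>. (\<tau> \<omega>, \<omega>))"
  proof (rule pair_measure_eqI)
    show "sigma_finite_measure (distr M S \<tau>)" "sigma_finite_measure P" by unfold_locales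
    show "sets (distr M S \<tau> \<Otimes>\<^sub>M P) = sets (distr M (S \<Otimes>\<^sub>M G) (\<lambda>\<omega>. (\<tau> \<omega>, \<omega>)))"
      by (simp add: P_def cong: sets_pair_measure_cong)
    fix A B assume "A \<in> sets (distr M S \<tau>)" "B \<in> sets P"
    then have [measurable]: "A \<in> sets S" "B \<in> sets G" by (auto simp: P_def)
    have B: "B \<subseteq> space M" using sets.sets_into_space[OF \<open>B \<in> sets G\<close>] G by simp
    have "prob ((\<tau> -` A \<inter> space M) \<inter> B) = prob (\<tau> -` A \<inter> space M) * prob B"
      by (intro indep_setD[OF indep] in_vimage_algebra) fact+
    moreover have "(\<lambda>\<omega>. (\<tau> \<omega>, \<omega>)) -` (A \<times> B) \<inter> space M = (\<tau> -` A \<inter> space M) \<inter> B"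
      using B by auto
    moreover have "(\<lambda>\<omega>. \<omega>) -` B \<inter> space M = B" using B by auto
    ultimately show "emeasure (distr M S \<tau>) A * emeasure P B = emeasure (distr M (S \<Otimes>\<^sub>M G) (\<lambda>\<omega>. (\<tau> \<omega>, \<omega>))) (A \<times> B)"
      by (simp add: P_def emeasure_distr emeasure_eq_measure ennreal_mult)
  qed
  then have eq: "distr M (S \<Otimes>\<^sub>M G) (\<lambda>\<omega>. (\<tau> \<omega>, \<omega>)) = distr M S \<tau> \<Otimes>\<^sub>M P" ..
  have "(\<integral>\<^sup>+\<omega>. k (\<tau> \<omega>) \<omega> \<partial>M) = (\<integral>\<^sup>+x. (\<lambda>(t, \<omega>). k t \<omega>) x \<partial>distr M (S \<Otimes>\<^sub>M G) (\<lambda>\<omega>. (\<tau> \<omega>, \<omega>)))"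
    by (subst nn_integral_distr) auto
  also have "\<dots> = (\<integral>\<^sup>+t. (\<integral>\<^sup>+\<omega>. k t \<omega> \<partial>P) \<partial>distr M S \<tau>)"
  proof -
    have "(\<lambda>(t, \<omega>). k t \<omega>) \<in> borel_measurable (distr M S \<tau> \<Otimes>\<^sub>M P)"
      using k by (simp add: P_def cong: measurable_cong_sets sets_pair_measure_cong)
    from P.nn_integral_fst[OF this] show ?thesis unfolding eq by simp
  qed
  also have "\<dots> = (\<integral>\<^sup>+t. (\<integral>\<^sup>+\<omega>. k t \<omega> \<partial>M) \<partial>distr M S \<tau>)"
  proof (rule nn_integral_cong)
    fix t assume "t \<in> space (distr M S \<tau>)"
    then have "(\<lambda>\<omega>. k t \<omega>) \<in> borel_measurable G"
      using measurable_Pair2[OF k, of t] by simp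
    then show "(\<integral>\<^sup>+\<omega>. k t \<omega> \<partial>P) = (\<integral>\<^sup>+\<omega>. k t \<omega> \<partial>M)"
      unfolding P_def by (subst nn_integral_distr) auto
  qed
  finally show ?thesis .
qed

text \<open>\<open>X\<close> may be exchanged for \<open>V\<close> only at a fixed time, so
  \<open>\<tau>\<close> is frozen first. From then on independence is no longer used, which is why
  \<open>V\<close> is measurable with respect to \<open>M\<close> and \<open>X\<close> with respect
  to \<open>G\<close>. The factor \<open>T\<close> cancels the uniform density.\<close>

lemma (in prob_space) nn_integral_random_time_residual:
  fixes \<tau> :: "'a \<Rightarrow> real" and k :: "real \<Rightarrow> 's \<Rightarrow> 'b \<Rightarrow> ennreal"
  assumes "0 < T" and \<tau>: "\<tau> \<in> borel_measurable M"
    and uniform: "distr M borel \<tau> = uniform_measure lborel {0<..<T}"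
    and G: "space G = space M"
    and indep: "indep_set (sets (vimage_algebra (space M) \<tau> borel)) (sets G)"
    and Z[measurable]: "Z \<in> measurable G S"
    and X[measurable]: "(\<lambda>(t, \<omega>). X t \<omega>) \<in> measurable (borel \<Otimes>\<^sub>M G) B"
    and V[measurable]: "(\<lambda>(t, \<omega>). V t \<omega>) \<in> measurable (borel \<Otimes>\<^sub>M M) B"
    and k[measurable]: "(\<lambda>(t, z, v). k t z v) \<in> borel_measurable (borel \<Otimes>\<^sub>M S \<Otimes>\<^sub>M B)"
    and law: "\<And>t. t \<in> {0..T} \<Longrightarrow>
      distr M (S \<Otimes>\<^sub>M B) (\<lambda>\<omega>. (Z \<omega>, X t \<omega>)) = distr M (S \<Otimes>\<^sub>M B) (\<lambda>\<omega>. (Z \<omega>, V t \<omega>))"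
  shows "ennreal T * (\<integral>\<^sup>+\<omega>. k (\<tau> \<omega>) (Z \<omega>) (X (\<tau> \<omega>) \<omega>) \<partial>M) =
    (\<integral>\<^sup>+\<omega>. (\<integral>\<^sup>+t\<in>{0..T}. k t (Z \<omega>) (V t \<omega>) \<partial>lborel) \<partial>M)"
proof -
  have id[measurable]: "(\<lambda>\<omega>. \<omega>) \<in> measurable M G"
    using indep_setD_ev2[OF indep] G by (auto simp: measurable_def)
  have XM[measurable]: "(\<lambda>(t, \<omega>). X t \<omega>) \<in> measurable (borel \<Otimes>\<^sub>M M) B"
    using measurable_compose[OF _ X, of "\<lambda>x. (fst x, snd x)" "borel \<Otimes>\<^sub>M M"] by (simp add: case_prod_beta)
  have ZM[measurable]: "Z \<in> measurable M S"
    using measurable_compose[OF id Z] by simp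
  have comp: "(\<lambda>(t, \<omega>). k t (Z \<omega>) (W t \<omega>)) \<in> borel_measurable (borel \<Otimes>\<^sub>M H)"
    if [measurable]: "Z \<in> measurable H S" "(\<lambda>(t, \<omega>). W t \<omega>) \<in> measurable (borel \<Otimes>\<^sub>M H) B" for W H
    using measurable_compose[OF _ k, of "\<lambda>x. (fst x, Z (snd x), W (fst x) (snd x))" "borel \<Otimes>\<^sub>M H"]
    by (simp add: case_prod_beta)
  note [measurable] = comp[OF Z X] comp[OF ZM XM] comp[OF ZM V]
  interpret lborel: pair_sigma_finite lborel M by unfold_locales
  define q where "q t = (\<integral>\<^sup>+\<omega>. k t (Z \<omega>) (X t \<omega>) \<partial>M)" for t
  have [measurable]: "q \<in> borel_measurable borel" unfolding q_def by measurable
  have "(\<integral>\<^sup>+\<omega>. k (\<tau> \<omega>) (Z \<omega>) (X (\<tau> \<omega>) \<omega>) \<partial>M) = (\<integral>\<^sup>+t. q t \<partial>distr M borel \<tau>)"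
    unfolding q_def by (rule nn_integral_indep_time[OF \<tau> G indep comp[OF Z X]])
  also have "\<dots> = (\<integral>\<^sup>+t. q t * indicator {0<..<T} t \<partial>lborel) / ennreal T"
    unfolding uniform using \<open>0 < T\<close> by (subst nn_integral_uniform_measure) auto
  also have "(\<integral>\<^sup>+t. q t * indicator {0<..<T} t \<partial>lborel) = (\<integral>\<^sup>+t. q t * indicator {0..T} t \<partial>lborel)"
  proof (rule nn_integral_cong_AE)
    show "AE t in lborel. q t * indicator {0<..<T} t = q t * indicator {0..T} t"
      using AE_lborel_singleton[of 0] AE_lborel_singleton[of T]
      by eventually_elim (auto split: split_indicator)
  qed
  also have "\<dots> = (\<integral>\<^sup>+t. (\<integral>\<^sup>+\<omega>. k t (Z \<omega>) (V t \<omega>) * indicator {0..T} t \<partial>M) \<partial>lborel)"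
  proof (rule nn_integral_cong)
    fix t :: real
    have [measurable]: "(\<lambda>(z, v). k t z v) \<in> borel_measurable (S \<Otimes>\<^sub>M B)"
      using measurable_Pair2[OF k, of t] by simp
    have [measurable]: "X t \<in> measurable M B" "V t \<in> measurable M B"
      using measurable_Pair2[OF XM, of t] measurable_Pair2[OF V, of t] by simp_all
    have eq: "(\<integral>\<^sup>+\<omega>. k t (Z \<omega>) (W \<omega>) \<partial>M) = (\<integral>\<^sup>+x. (\<lambda>(z, v). k t z v) x \<partial>distr M (S \<Otimes>\<^sub>M B) (\<lambda>\<omega>. (Z \<omega>, W \<omega>)))"
      if [measurable]: "W \<in> measurable M B" for W
      by (subst nn_integral_distr) auto
    show "q t * indicator {0..T} t = (\<integral>\<^sup>+\<omega>. k t (Z \<omega>) (V t \<omega>) * indicator {0..T} t \<partial>M)"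
    proof (cases "t \<in> {0..T}")
      case True
      then show ?thesis
        using eq[of "X t"] eq[of "V t"] law[OF True] by (simp add: q_def)
    qed simp
  qed
  also have "\<dots> = (\<integral>\<^sup>+\<omega>. (\<integral>\<^sup>+t\<in>{0..T}. k t (Z \<omega>) (V t \<omega>) \<partial>lborel) \<partial>M)"
    by (subst lborel.Fubini'[symmetric]) (auto simp: case_prod_beta)
  finally have eq: "(\<integral>\<^sup>+\<omega>. k (\<tau> \<omega>) (Z \<omega>) (X (\<tau> \<omega>) \<omega>) \<partial>M) =
    (\<integral>\<^sup>+\<omega>. (\<integral>\<^sup>+t\<in>{0..T}. k t (Z \<omega>) (V t \<omega>) \<partial>lborel) \<partial>M) / ennreal T" .
  have "ennreal T * (x / ennreal T) = x" for x
    unfolding ennreal_times_divide mult.commute[of "ennreal T"]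
    using \<open>0 < T\<close> by (intro ennreal_mult_divide_eq) auto
  then show ?thesis unfolding eq .
qed

section \<open>Error and residual\<close>

lemma ennreal_sqrt_power2: "(ennreal_sqrt x)\<^sup>2 = x"
  by (cases x) (auto simp: ennreal_sqrt_def ennreal_power)

lemma ennreal_sqrt_le_iff: "ennreal_sqrt x \<le> y \<longleftrightarrow> x \<le> y\<^sup>2"
  by (cases x; cases y)
     (auto simp: ennreal_sqrt_def ennreal_power real_sqrt_le_iff' top_unique sqrt_le_D power2_eq_square[of \<top>] real_le_lsqrt ennreal_top_mult)

lemma ennreal_sqrt_mono: "x \<le> y \<Longrightarrow> ennreal_sqrt x \<le> ennreal_sqrt y"
  by (simp add: ennreal_sqrt_le_iff ennreal_sqrt_power2)

lemma ennreal_sqrt_add_le: "ennreal_sqrt (x + y) \<le> ennreal_sqrt x + ennreal_sqrt y"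
proof -
  have "x + y = (ennreal_sqrt x)\<^sup>2 + (ennreal_sqrt y)\<^sup>2"
    by (simp add: ennreal_sqrt_power2)
  also have "\<dots> \<le> (ennreal_sqrt x + ennreal_sqrt y)\<^sup>2"
    unfolding power2_eq_square by (auto simp: distrib_left distrib_right intro!: add_mono)
  finally show ?thesis by (simp add: ennreal_sqrt_le_iff)
qed

lemma ennreal_sqrt_mult_le:
  assumes "0 \<le> c"
  shows "ennreal_sqrt (ennreal c * x) \<le> ennreal (sqrt c) * ennreal_sqrt x"
  using assms by (simp add: ennreal_sqrt_le_iff power_mult_distrib ennreal_sqrt_power2 ennreal_power)

text \<open>Here \<open>e\<close> is the error and \<open>l\<close> the loss. The inequality
  \<open>le\<close> passes to infima, so the smallest attainable loss is controlled by the best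
  approximation error; \<open>el\<close> then turns loss back into error.\<close>

lemma quasi_optimality:
  fixes e l :: "'i \<Rightarrow> ennreal"
  assumes "0 \<le> C" "0 < D"
    and el: "\<And>v. v \<in> W \<Longrightarrow> e v \<le> ennreal C * ennreal_sqrt (l v)"
    and le: "\<And>v. v \<in> W \<Longrightarrow> ennreal_sqrt (l v) \<le> ennreal D * e v"
    and w: "w \<in> W"
  shows "e w \<le> ennreal (C * (1 + D)) * ((INF v\<in>W. e v) + ennreal_sqrt (l w - (INF v\<in>W. l v)))"
    and "is_arg_min l (\<lambda>v. v \<in> W) w \<Longrightarrow> e w \<le> ennreal (C * (1 + D)) * (INF v\<in>W. e v)"
proof -
  define il where "il = (INF v\<in>W. l v)"
  define ie where "ie = (INF v\<in>W. e v)"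
  \<comment> \<open>Dividing by \<open>D\<close> first leaves the infimum bare, so that it suffices
    to compare with each single \<open>e v\<close>.\<close>
  have "ennreal (1 / D) * ennreal_sqrt il \<le> ie"
    unfolding ie_def
  proof (rule INF_greatest)
    fix v assume v: "v \<in> W"
    have "ennreal_sqrt il \<le> ennreal_sqrt (l v)"
      unfolding il_def by (intro ennreal_sqrt_mono INF_lower v)
    also have "\<dots> \<le> ennreal D * e v" by (rule le[OF v])
    finally have "ennreal (1 / D) * ennreal_sqrt il \<le> ennreal (1 / D) * (ennreal D * e v)"
      by (rule mult_left_mono) simp
    also have "\<dots> = e v"
      using \<open>0 < D\<close> by (simp add: mult.assoc[symmetric] flip: ennreal_mult)
    finally show "ennreal (1 / D) * ennreal_sqrt il \<le> e v" .
  qed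
  then have "ennreal D * (ennreal (1 / D) * ennreal_sqrt il) \<le> ennreal D * ie"
    by (rule mult_left_mono) simp
  then have il: "ennreal_sqrt il \<le> ennreal D * ie"
    using \<open>0 < D\<close> by (simp add: mult.assoc[symmetric] flip: ennreal_mult)
  have "il \<le> l w" unfolding il_def by (intro INF_lower w)
  then have "l w = (l w - il) + il" by (simp add: diff_add_cancel_ennreal)
  then have "ennreal_sqrt (l w) \<le> ennreal_sqrt (l w - il) + ennreal_sqrt il"
    using ennreal_sqrt_add_le by metis
  also have "\<dots> \<le> ennreal_sqrt (l w - il) + ennreal D * ie"
    by (intro add_left_mono il)
  \<comment> \<open>Both coefficients, 1 and \<open>D\<close>, are enlarged to \<open>1 + D\<close>
    so that one constant multiplies the sum.\<close>
  also have "\<dots> \<le> ennreal (1 + D) * ennreal_sqrt (l w - il) + ennreal (1 + D) * ie"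
    using \<open>0 < D\<close> mult_right_mono[of 1 "ennreal (1 + D)" "ennreal_sqrt (l w - il)"]
    by (intro add_mono mult_right_mono ennreal_leI) auto
  finally have "ennreal_sqrt (l w) \<le> ennreal (1 + D) * (ie + ennreal_sqrt (l w - il))"
    by (simp add: distrib_left add.commute)
  then have "ennreal C * ennreal_sqrt (l w) \<le> ennreal C * (ennreal (1 + D) * (ie + ennreal_sqrt (l w - il)))"
    by (rule mult_left_mono) simp
  with el[OF w] show "e w \<le> ennreal (C * (1 + D)) * ((INF v\<in>W. e v) + ennreal_sqrt (l w - (INF v\<in>W. l v)))"
    using \<open>0 \<le> C\<close> \<open>0 < D\<close> by (simp add: ie_def il_def ennreal_mult mult.assoc)
  \<comment> \<open>Setting the gap to zero in the first bound would fail for an infinite infimum,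
    since \<open>\<top> - \<top>\<close> is \<open>\<top>\<close> in \<open>ennreal\<close>. The
    minimal loss is therefore estimated directly.\<close>
  show "e w \<le> ennreal (C * (1 + D)) * (INF v\<in>W. e v)" if "is_arg_min l (\<lambda>v. v \<in> W) w"
  proof -
    have "l w \<le> il"
      unfolding il_def using that by (intro INF_greatest) (auto simp: is_arg_min_linorder)
    have "e w \<le> ennreal C * ennreal_sqrt (l w)" by (rule el[OF w])
    also have "\<dots> \<le> ennreal C * (ennreal D * ie)"
      using ennreal_sqrt_mono[OF \<open>l w \<le> il\<close>] il by (intro mult_left_mono) auto
    also have "\<dots> = ennreal (C * D) * ie"
      using \<open>0 \<le> C\<close> \<open>0 < D\<close> by (simp add: ennreal_mult mult.assoc)
    also have "\<dots> \<le> ennreal (C * (1 + D)) * ie"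
      using \<open>0 \<le> C\<close> \<open>0 < D\<close> by (intro mult_right_mono ennreal_leI mult_left_mono) auto
    finally show ?thesis by (simp add: ie_def)
  qed
qed

text \<open>\<open>z\<close> is the error, \<open>\<zeta>\<close> a jointly measurable version of
  it, \<open>\<delta>\<close> its right derivative and \<open>\<rho>\<close> the residual. Gronwall
  bounds the supremum by the residual; the estimate \<open>bounds\<close> lets
  \<open>\<delta>\<close> and \<open>\<rho>\<close> be exchanged at the price of \<open>K\<close>
  times the error.\<close>

lemma norm1_residual_equivalence:
  fixes z \<zeta> \<delta> \<rho> :: "real \<Rightarrow> 'a \<Rightarrow> 'b::euclidean_space" and K T :: real
  assumes M: "prob_space M" and "0 < T" "0 \<le> K"
    and meas[measurable]: "(\<lambda>(t, \<omega>). \<zeta> t \<omega>) \<in> borel_measurable (borel \<Otimes>\<^sub>M M)"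
      "(\<lambda>(t, \<omega>). \<delta> t \<omega>) \<in> borel_measurable (borel \<Otimes>\<^sub>M M)"
      "(\<lambda>(t, \<omega>). \<rho> t \<omega>) \<in> borel_measurable (borel \<Otimes>\<^sub>M M)"
    and cont: "AE \<omega> in M. continuous_on {0..T} (\<lambda>t. z t \<omega>)"
    and z: "AE \<omega> in M. \<forall>t\<in>{0..T}. z t \<omega> = \<zeta> t \<omega>"
    and der: "AE \<omega> in M. \<forall>t\<in>{0..<T}. ((\<lambda>s. z s \<omega>) has_vector_derivative \<delta> t \<omega>) (at_right t)"
    and bounds: "AE \<omega> in M. \<forall>t\<in>{0..<T}. norm (\<delta> t \<omega> - \<rho> t \<omega>) \<le> K * norm (z t \<omega>)"
    and right: "AE \<omega> in M. \<forall>t\<in>{0..<T}. ((\<lambda>s. \<rho> s \<omega>) \<longlongrightarrow> \<rho> t \<omega>) (at_right t)"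
  defines "E \<equiv> exp ((2 * K + 1) * T)"
    and "J \<equiv> (\<integral>\<^sup>+\<omega>. ennreal ((norm (\<zeta> 0 \<omega>))\<^sup>2) + (\<integral>\<^sup>+t\<in>{0..T}. ennreal ((norm (\<rho> t \<omega>))\<^sup>2) \<partial>lborel) \<partial>M)"
  shows "norm1 M T z \<le> ennreal (sqrt E + sqrt (2 * K\<^sup>2 * T * E + 2)) * ennreal_sqrt J"
    and "ennreal_sqrt J \<le> ennreal (sqrt (1 + 2 * K\<^sup>2 * T) + sqrt 2) * norm1 M T z"
  \<comment> \<open>The supremum \<open>S\<close> below need not be measurable, so its integral is never split; only
    measurable lower bounds of it are.\<close>
proof -
  interpret M: prob_space M by fact
  define R where "R \<omega> = ennreal ((norm (\<zeta> 0 \<omega>))\<^sup>2) + (\<integral>\<^sup>+t\<in>{0..T}. ennreal ((norm (\<rho> t \<omega>))\<^sup>2) \<partial>lborel)" for \<omega>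
  define S where "S \<omega> = (SUP t\<in>{0..T}. ennreal ((norm (z t \<omega>))\<^sup>2))" for \<omega>
  define D where "D \<omega> = (\<integral>\<^sup>+t\<in>{0..T}. ennreal ((norm (right_deriv (\<lambda>s. z s \<omega>) t))\<^sup>2) \<partial>lborel)" for \<omega>
  define D' where "D' \<omega> = (\<integral>\<^sup>+t\<in>{0..T}. ennreal ((norm (\<delta> t \<omega>))\<^sup>2) \<partial>lborel)" for \<omega>
  define I where "I \<omega> = (\<integral>\<^sup>+t\<in>{0..T}. ennreal ((norm (\<zeta> t \<omega>))\<^sup>2) \<partial>lborel)" for \<omega>
  have [measurable]: "\<zeta> 0 \<in> borel_measurable M"
    using measurable_Pair2[OF meas(1), of 0] by simp
  have [measurable]: "R \<in> borel_measurable M" "D' \<in> borel_measurable M" "I \<in> borel_measurable M"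
    unfolding R_def D'_def I_def by measurable
  have J: "J = (\<integral>\<^sup>+\<omega>. R \<omega> \<partial>M)" by (simp add: J_def R_def)
  have norm1: "norm1 M T z = ennreal_sqrt (\<integral>\<^sup>+\<omega>. S \<omega> \<partial>M) + ennreal_sqrt (\<integral>\<^sup>+\<omega>. D \<omega> \<partial>M)"
    by (simp add: norm1_def S_def D_def)
  have not_T: "AE t in lborel. t \<noteq> T" by (rule AE_lborel_singleton)
  \<comment> \<open>The estimate is symmetric in \<open>u\<close> and \<open>v\<close> up to a sign,
    and is applied below both to the derivative and to the residual.\<close>
  have squares: "ennreal ((norm u)\<^sup>2) \<le> ennreal (2 * K\<^sup>2) * ennreal ((norm x)\<^sup>2) + 2 * ennreal ((norm v)\<^sup>2)"
    if "norm (u - v) \<le> K * norm x" for u v x :: 'b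
  proof -
    have "norm u \<le> K * norm x + norm v" using that norm_triangle_ineq2[of u v] by simp
    then have "(norm u)\<^sup>2 \<le> (K * norm x + norm v)\<^sup>2" by (rule power_mono) simp
    also have "\<dots> \<le> 2 * K\<^sup>2 * (norm x)\<^sup>2 + 2 * (norm v)\<^sup>2"
      using sum_squares_bound[of "K * norm x" "norm v"] by (simp add: power2_sum power_mult_distrib)
    finally have "ennreal ((norm u)\<^sup>2) \<le> ennreal (2 * K\<^sup>2 * (norm x)\<^sup>2 + 2 * (norm v)\<^sup>2)"
      by (rule ennreal_leI)
    then show ?thesis by (simp add: ennreal_mult)
  qed
  have D_eq: "AE \<omega> in M. D \<omega> = D' \<omega>"
    using der
  proof eventually_elim
    fix \<omega> assume *: "\<forall>t\<in>{0..<T}. ((\<lambda>s. z s \<omega>) has_vector_derivative \<delta> t \<omega>) (at_right t)"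
    have "right_deriv (\<lambda>s. z s \<omega>) t = \<delta> t \<omega>" if "t \<in> {0..<T}" for t
      unfolding right_deriv_def
      by (rule vector_derivative_within) (use * that in \<open>auto simp: trivial_limit_at_right_real\<close>)
    then show "D \<omega> = D' \<omega>"
      unfolding D_def D'_def using not_T
      by (intro nn_integral_cong_AE) (auto elim!: eventually_mono split: split_indicator)
  qed
  have SR: "AE \<omega> in M. S \<omega> \<le> ennreal E * R \<omega>"
    using cont z der bounds right AE_space
  proof eventually_elim
    case (elim \<omega>)
    have [measurable]: "(\<lambda>t. \<rho> t \<omega>) \<in> borel_measurable borel"
      using measurable_Pair1[OF meas(3) elim(6)] by simp
    have "ennreal ((norm (z t \<omega>))\<^sup>2) \<le> ennreal E * R \<omega>" if t: "t \<in> {0..T}" for t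
    proof -
      have "ennreal ((norm (z t \<omega>))\<^sup>2) \<le> ennreal (exp ((2 * K + 1) * T)) *
        (ennreal ((norm (z 0 \<omega>))\<^sup>2) + (\<integral>\<^sup>+s\<in>{0..T}. ennreal ((norm (\<rho> s \<omega>))\<^sup>2) \<partial>lborel))"
      proof (rule gronwall_right_derivative_nn_integral[OF \<open>0 \<le> K\<close> t elim(1)])
        fix s assume s: "s \<in> {0..<T}"
        show "((\<lambda>s. z s \<omega>) has_vector_derivative \<delta> s \<omega>) (at_right s)" using elim(3) s by blast
        have "norm (\<delta> s \<omega> - \<rho> s \<omega>) \<le> K * norm (z s \<omega>)" using elim(4) s by blast
        then show "norm (\<delta> s \<omega>) \<le> K * norm (z s \<omega>) + norm (\<rho> s \<omega>)"
          using norm_triangle_ineq2[of "\<delta> s \<omega>" "\<rho> s \<omega>"] by simp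
        show "((\<lambda>s. norm (\<rho> s \<omega>)) \<longlongrightarrow> norm (\<rho> s \<omega>)) (at_right s)"
          using elim(5) s by (intro tendsto_norm) blast
      qed measurable
      moreover have "z 0 \<omega> = \<zeta> 0 \<omega>" using elim(2) \<open>0 < T\<close> by simp
      ultimately show ?thesis by (simp add: R_def E_def)
    qed
    then show "S \<omega> \<le> ennreal E * R \<omega>" unfolding S_def by (intro SUP_least)
  qed
  have IS: "AE \<omega> in M. I \<omega> \<le> ennreal T * S \<omega>"
    using z
  proof eventually_elim
    fix \<omega> assume *: "\<forall>t\<in>{0..T}. z t \<omega> = \<zeta> t \<omega>"
    have "ennreal ((norm (\<zeta> t \<omega>))\<^sup>2) \<le> S \<omega>" if t: "t \<in> {0..T}" for t
      using SUP_upper[OF t, of "\<lambda>t. ennreal ((norm (z t \<omega>))\<^sup>2)"] * t unfolding S_def by simp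
    then have "I \<omega> \<le> (\<integral>\<^sup>+t. S \<omega> * indicator {0..T} t \<partial>lborel)"
      unfolding I_def by (intro nn_integral_mono) (auto split: split_indicator)
    also have "\<dots> = ennreal T * S \<omega>"
      using \<open>0 < T\<close> by (simp add: nn_integral_cmult_indicator mult.commute)
    finally show "I \<omega> \<le> ennreal T * S \<omega>" .
  qed
  have ID: "AE \<omega> in M. D' \<omega> \<le> ennreal (2 * K\<^sup>2) * I \<omega> + 2 * (\<integral>\<^sup>+t\<in>{0..T}. ennreal ((norm (\<rho> t \<omega>))\<^sup>2) \<partial>lborel)
      \<and> (\<integral>\<^sup>+t\<in>{0..T}. ennreal ((norm (\<rho> t \<omega>))\<^sup>2) \<partial>lborel) \<le> ennreal (2 * K\<^sup>2) * I \<omega> + 2 * D' \<omega>"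
    using bounds z AE_space
  proof eventually_elim
    case (elim \<omega>)
    have [measurable]: "(\<lambda>t. \<rho> t \<omega>) \<in> borel_measurable borel" "(\<lambda>t. \<delta> t \<omega>) \<in> borel_measurable borel"
      "(\<lambda>t. \<zeta> t \<omega>) \<in> borel_measurable borel"
      using meas[THEN measurable_Pair1, OF elim(3)] by simp_all
    have *: "(\<integral>\<^sup>+t\<in>{0..T}. ennreal ((norm (u t))\<^sup>2) \<partial>lborel) \<le>
        ennreal (2 * K\<^sup>2) * I \<omega> + 2 * (\<integral>\<^sup>+t\<in>{0..T}. ennreal ((norm (v t))\<^sup>2) \<partial>lborel)"
      if [measurable]: "v \<in> borel_measurable borel"
        and uv: "\<And>t. t \<in> {0..<T} \<Longrightarrow> norm (u t - v t) \<le> K * norm (\<zeta> t \<omega>)" for u v :: "real \<Rightarrow> 'b"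
    proof -
      have "(\<integral>\<^sup>+t\<in>{0..T}. ennreal ((norm (u t))\<^sup>2) \<partial>lborel) \<le>
        (\<integral>\<^sup>+t. ennreal (2 * K\<^sup>2) * (ennreal ((norm (\<zeta> t \<omega>))\<^sup>2) * indicator {0..T} t)
            + 2 * (ennreal ((norm (v t))\<^sup>2) * indicator {0..T} t) \<partial>lborel)"
        using not_T by (intro nn_integral_mono_AE)
          (auto elim!: eventually_mono split: split_indicator intro!: squares uv)
      also have "\<dots> = ennreal (2 * K\<^sup>2) * I \<omega> + 2 * (\<integral>\<^sup>+t\<in>{0..T}. ennreal ((norm (v t))\<^sup>2) \<partial>lborel)"
        unfolding I_def by (subst nn_integral_add) (simp_all add: nn_integral_cmult)
      finally show ?thesis .
    qed
    show ?case
      unfolding D'_def using elim(1,2) by (intro conjI *) (auto simp: norm_minus_commute)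
  qed
  \<comment> \<open>\<open>I\<close> is at most \<open>T\<close> times the supremum, which Gronwall
    bounds by \<open>E * R\<close>; together with twice the residual this gives the
    constant.\<close>
  have "AE \<omega> in M. D \<omega> \<le> ennreal (2 * K\<^sup>2 * T * E + 2) * R \<omega>"
    using D_eq SR IS ID
  proof eventually_elim
    case (elim \<omega>)
    have "D \<omega> \<le> ennreal (2 * K\<^sup>2) * I \<omega> + 2 * (\<integral>\<^sup>+t\<in>{0..T}. ennreal ((norm (\<rho> t \<omega>))\<^sup>2) \<partial>lborel)"
      using elim by simp
    also have "\<dots> \<le> ennreal (2 * K\<^sup>2) * (ennreal T * (ennreal E * R \<omega>)) + 2 * R \<omega>"
      using order_trans[OF elim(3) mult_left_mono[OF elim(2)]]
      by (intro add_mono mult_left_mono) (auto simp: R_def)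
    also have "\<dots> = ennreal (2 * K\<^sup>2 * T * E + 2) * R \<omega>"
      using \<open>0 < T\<close> by (simp add: E_def ennreal_mult distrib_right mult.assoc)
    finally show ?case .
  qed
  then have "(\<integral>\<^sup>+\<omega>. D \<omega> \<partial>M) \<le> (\<integral>\<^sup>+\<omega>. ennreal (2 * K\<^sup>2 * T * E + 2) * R \<omega> \<partial>M)"
    by (rule nn_integral_mono_AE)
  also have "\<dots> = ennreal (2 * K\<^sup>2 * T * E + 2) * J"
    unfolding J by (rule nn_integral_cmult) measurable
  finally have D: "ennreal_sqrt (\<integral>\<^sup>+\<omega>. D \<omega> \<partial>M) \<le> ennreal (sqrt (2 * K\<^sup>2 * T * E + 2)) * ennreal_sqrt J"
    using \<open>0 < T\<close> by (intro order_trans[OF ennreal_sqrt_mono ennreal_sqrt_mult_le]) (auto simp: E_def)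
  have "(\<integral>\<^sup>+\<omega>. S \<omega> \<partial>M) \<le> (\<integral>\<^sup>+\<omega>. ennreal E * R \<omega> \<partial>M)"
    using SR by (rule nn_integral_mono_AE)
  also have "\<dots> = ennreal E * J"
    unfolding J by (rule nn_integral_cmult) measurable
  finally have "ennreal_sqrt (\<integral>\<^sup>+\<omega>. S \<omega> \<partial>M) \<le> ennreal (sqrt E) * ennreal_sqrt J"
    by (intro order_trans[OF ennreal_sqrt_mono ennreal_sqrt_mult_le]) (auto simp: E_def)
  with D show "norm1 M T z \<le> ennreal (sqrt E + sqrt (2 * K\<^sup>2 * T * E + 2)) * ennreal_sqrt J"
    using \<open>0 < T\<close> unfolding norm1 by (simp add: E_def distrib_right add_mono)

  \<comment> \<open>For the converse, the initial value is dominated by \<open>S\<close> and, in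
    integrated form, \<open>I\<close> by \<open>T * S\<close>. They combine to
    \<open>1 + 2 * K\<^sup>2 * T\<close>; the derivative contributes the factor 2.\<close>
  have "AE \<omega> in M. R \<omega> \<le> ennreal ((norm (\<zeta> 0 \<omega>))\<^sup>2) + (ennreal (2 * K\<^sup>2) * I \<omega> + 2 * D' \<omega>)"
    using ID unfolding R_def by eventually_elim (auto intro: add_left_mono)
  then have "J \<le> (\<integral>\<^sup>+\<omega>. ennreal ((norm (\<zeta> 0 \<omega>))\<^sup>2) + (ennreal (2 * K\<^sup>2) * I \<omega> + 2 * D' \<omega>) \<partial>M)"
    unfolding J by (rule nn_integral_mono_AE)
  also have "\<dots> = (\<integral>\<^sup>+\<omega>. ennreal ((norm (\<zeta> 0 \<omega>))\<^sup>2) \<partial>M) +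
      (ennreal (2 * K\<^sup>2) * (\<integral>\<^sup>+\<omega>. I \<omega> \<partial>M) + 2 * (\<integral>\<^sup>+\<omega>. D' \<omega> \<partial>M))"
    by (simp add: nn_integral_add nn_integral_cmult)
  also have "\<dots> \<le> (\<integral>\<^sup>+\<omega>. S \<omega> \<partial>M) +
      (ennreal (2 * K\<^sup>2) * (ennreal T * (\<integral>\<^sup>+\<omega>. S \<omega> \<partial>M)) + 2 * (\<integral>\<^sup>+\<omega>. D \<omega> \<partial>M))"
  proof (intro add_mono mult_left_mono)
    show "(\<integral>\<^sup>+\<omega>. ennreal ((norm (\<zeta> 0 \<omega>))\<^sup>2) \<partial>M) \<le> (\<integral>\<^sup>+\<omega>. S \<omega> \<partial>M)"
    proof (rule nn_integral_mono_AE, use z in eventually_elim)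
      fix \<omega> assume "\<forall>t\<in>{0..T}. z t \<omega> = \<zeta> t \<omega>"
      then show "ennreal ((norm (\<zeta> 0 \<omega>))\<^sup>2) \<le> S \<omega>"
        using SUP_upper[of 0 "{0..T}" "\<lambda>t. ennreal ((norm (z t \<omega>))\<^sup>2)"] \<open>0 < T\<close> unfolding S_def by simp
    qed
    \<comment> \<open>The factor \<open>T\<close> is moved to the measurable \<open>I\<close> before
      integrating, so no constant is pulled out of an integral of \<open>S\<close>.\<close>
    have "(\<integral>\<^sup>+\<omega>. ennreal (1 / T) * I \<omega> \<partial>M) \<le> (\<integral>\<^sup>+\<omega>. S \<omega> \<partial>M)"
    proof (rule nn_integral_mono_AE, use IS in eventually_elim)
      fix \<omega> assume "I \<omega> \<le> ennreal T * S \<omega>"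
      then have "ennreal (1 / T) * I \<omega> \<le> ennreal (1 / T) * (ennreal T * S \<omega>)"
        by (rule mult_left_mono) simp
      then show "ennreal (1 / T) * I \<omega> \<le> S \<omega>"
        using \<open>0 < T\<close> by (simp add: mult.assoc[symmetric] flip: ennreal_mult)
    qed
    then have "ennreal T * (ennreal (1 / T) * (\<integral>\<^sup>+\<omega>. I \<omega> \<partial>M)) \<le> ennreal T * (\<integral>\<^sup>+\<omega>. S \<omega> \<partial>M)"
      by (intro mult_left_mono) (simp_all add: nn_integral_cmult)
    then show "(\<integral>\<^sup>+\<omega>. I \<omega> \<partial>M) \<le> ennreal T * (\<integral>\<^sup>+\<omega>. S \<omega> \<partial>M)"
      using \<open>0 < T\<close> by (simp add: mult.assoc[symmetric] flip: ennreal_mult)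
    show "(\<integral>\<^sup>+\<omega>. D' \<omega> \<partial>M) \<le> (\<integral>\<^sup>+\<omega>. D \<omega> \<partial>M)"
      using D_eq by (intro nn_integral_mono_AE) auto
  qed auto
  also have "\<dots> = ennreal (1 + 2 * K\<^sup>2 * T) * (\<integral>\<^sup>+\<omega>. S \<omega> \<partial>M) + ennreal 2 * (\<integral>\<^sup>+\<omega>. D \<omega> \<partial>M)"
    using \<open>0 < T\<close> by (simp add: ennreal_mult distrib_right mult.assoc add.assoc)
  finally have "ennreal_sqrt J \<le> ennreal_sqrt (ennreal (1 + 2 * K\<^sup>2 * T) * (\<integral>\<^sup>+\<omega>. S \<omega> \<partial>M)) +
      ennreal_sqrt (ennreal 2 * (\<integral>\<^sup>+\<omega>. D \<omega> \<partial>M))"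
    by (intro order_trans[OF ennreal_sqrt_mono ennreal_sqrt_add_le])
  also have "\<dots> \<le> ennreal (sqrt (1 + 2 * K\<^sup>2 * T)) * ennreal_sqrt (\<integral>\<^sup>+\<omega>. S \<omega> \<partial>M) +
      ennreal (sqrt 2) * ennreal_sqrt (\<integral>\<^sup>+\<omega>. D \<omega> \<partial>M)"
    using \<open>0 < T\<close> by (intro add_mono ennreal_sqrt_mult_le) auto
  also have "\<dots> \<le> ennreal (sqrt (1 + 2 * K\<^sup>2 * T) + sqrt 2) * norm1 M T z"
    using \<open>0 < T\<close> unfolding norm1 distrib_left by (intro add_mono mult_right_mono ennreal_leI) auto
  finally show "ennreal_sqrt J \<le> ennreal (sqrt (1 + 2 * K\<^sup>2 * T) + sqrt 2) * norm1 M T z" .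
qed

lemma network_loss_equivalence:
  fixes M :: "'a measure" and F :: "real \<Rightarrow> 'a measure"
    and T La :: real and x0 :: "real^'d" and \<sigma> :: "real^'m^'d"
    and a :: "real \<Rightarrow> real^'d \<Rightarrow> real^'d"
    and L Lb :: "real \<Rightarrow> 'a \<Rightarrow> real^'m" and Y :: "real \<Rightarrow> 'a \<Rightarrow> real^'d"
    and A :: "('d, 'm) ffnn" and \<tau> :: "'a \<Rightarrow> real"
  assumes "0 < T" and M: "prob_space M" and F: "usual_filtration M F"
    and levy: "levy_process M F T L"
    and A1: "continuous_on ({0..T} \<times> UNIV) (\<lambda>(t, y). a t y)"
    and A2: "0 \<le> La" "\<forall>t\<in>{0..T}. \<forall>y1 y2. norm (a t y1 - a t y2) \<le> La * norm (y1 - y2)"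
    and Y: "random_ode_solution M F T a \<sigma> x0 L Y"
    and p: "partition_of T n p" and A: "feedforward n N A"
    and D1: "net_process A L n p w \<in> D1 M F T"
    and \<tau>: "\<tau> \<in> borel_measurable M" and uniform: "distr M borel \<tau> = uniform_measure lborel {0<..<T}"
    and bridge: "exact_levy_bridge M T L n p Lb"
    and indep: "prob_space.indep_set M (sets (vimage_algebra (space M) \<tau> borel)) (sets (joint_sigma M T L Lb))"
  defines "E \<equiv> exp ((2 * La + 1) * T)"
    and "e \<equiv> norm1 M T (\<lambda>t \<omega>. net_process A L n p w t \<omega> - Y t \<omega>)"
    and "l \<equiv> loss M T a \<sigma> x0 L Lb \<tau> A n p w"
  shows "e \<le> ennreal (sqrt E + sqrt (2 * La\<^sup>2 * T * E + 2)) * ennreal_sqrt l"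
    and "ennreal_sqrt l \<le> ennreal (sqrt (1 + 2 * La\<^sup>2 * T) + sqrt 2) * e"
proof -
  interpret prob_space M by fact
  define S where "S = (\<Pi>\<^sub>M k\<in>{1..n}. (borel :: (real^'m) measure))"
  define Z where "Z = obs L n p"
  define v where "v = net_value A w"
  define G where "G = joint_sigma M T L Lb"
  \<comment> \<open>Clipping time extends \<open>a\<close> continuously beyond [0,T], so that
    measurability can be argued on the whole real line.\<close>
  define c where "c t = max 0 (min T t)" for t :: real
  define b where "b t y = a (c t) y" for t y
  define \<phi> where "\<phi> t y u = b t (y + \<sigma> *v u)" for t y u
  \<comment> \<open>This derivative sees the path only through the observations \<open>z\<close>, as
    the exchange of \<open>Lb\<close> for \<open>L\<close> requires. It agrees almost surely with
    the derivative process from \<open>D1\<close> on [0,T).\<close>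
  define g where "g t z = lim (\<lambda>i. real (Suc i) *\<^sub>R (v (t + 1 / real (Suc i)) z - v t z))" for t z

  have c: "c t \<in> {0..T}" "t \<in> {0..T} \<Longrightarrow> c t = t" for t
    using \<open>0 < T\<close> by (auto simp: c_def)
  have "continuous_on UNIV (\<lambda>x :: real \<times> (real^'d). (\<lambda>(t, y). a t y) (c (fst x), snd x))"
    by (rule continuous_on_compose2[OF A1]) (use c in \<open>auto simp: c_def intro!: continuous_intros\<close>)
  then have a_cont: "continuous_on UNIV (\<lambda>x. a (c (fst x)) (snd x))" by simp
  have \<phi>_tendsto: "((\<lambda>s. \<phi> s (y s) (u s)) \<longlongrightarrow> \<phi> t (y t) (u t)) (at_right t)"
    if "(y \<longlongrightarrow> y t) (at_right t)" "(u \<longlongrightarrow> u t) (at_right t)" for y u t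
  proof -
    have "((\<lambda>s. (s, y s + \<sigma> *v u s)) \<longlongrightarrow> (t, y t + \<sigma> *v u t)) (at_right t)"
      by (intro tendsto_Pair tendsto_ident_at tendsto_add that
          bounded_linear.tendsto[OF matrix_vector_mul_bounded_linear])
    from continuous_on_tendsto_compose[OF a_cont this] show ?thesis by (simp add: \<phi>_def b_def)
  qed
  have lip: "norm (\<phi> t y1 u - \<phi> t y2 u) \<le> La * norm (y1 - y2)" for t y1 y2 u
    using A2(2)[rule_format, OF c(1), of t "y1 + \<sigma> *v u" "y2 + \<sigma> *v u"] by (simp add: \<phi>_def b_def)

  have sub: "subalgebra M (F t)" if "t \<in> {0..T}" for t
    using F that by (auto simp: usual_filtration_def)
  have L_meas: "L t \<in> borel_measurable M" and Y_meas: "Y t \<in> borel_measurable M" if t: "t \<in> {0..T}" for t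
    using levy Y t by (auto simp: levy_process_def random_ode_solution_def adapted_on_def
        intro!: measurable_from_subalg[OF sub[OF t]])
  have L_right: "AE \<omega> in M. \<forall>t\<in>{0..<T}. ((\<lambda>s. L s \<omega>) \<longlongrightarrow> L t \<omega>) (at_right t)"
    using levy by (auto simp: levy_process_def cadlag_on_def)
  have right_cont: "(h \<longlongrightarrow> h t) (at_right t)" if "continuous_on {0..T} h" "t \<in> {0..<T}"
    for h :: "real \<Rightarrow> real^'d" and t
    using that by (intro continuous_on_Icc_at_rightD[of t T h]) (auto intro: continuous_on_subset)
  have Y_cont: "AE \<omega> in M. continuous_on {0..T} (\<lambda>t. Y t \<omega>)"
    and Y0: "AE \<omega> in M. Y 0 \<omega> = x0"
    and Y_der: "AE \<omega> in M. \<forall>t\<in>{0..<T}. ((\<lambda>s. Y s \<omega>) has_vector_derivative \<phi> t (Y t \<omega>) (L t \<omega>)) (at_right t)"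
    using Y c by (auto simp: random_ode_solution_def f_coeff_def \<phi>_def b_def)
  obtain V where V[measurable]: "(\<lambda>(t, \<omega>). V t \<omega>) \<in> borel_measurable (borel \<Otimes>\<^sub>M M)"
    and "\<forall>\<omega>. (\<forall>t\<in>{0..<T}. ((\<lambda>s. L s \<omega>) \<longlongrightarrow> L t \<omega>) (at_right t)) \<longrightarrow> (\<forall>t\<in>{0..T}. V t \<omega> = L t \<omega>)"
    using right_continuous_jointly_measurable_version[of T L M] \<open>0 < T\<close> L_meas by blast
  then have VL: "AE \<omega> in M. \<forall>t\<in>{0..T}. V t \<omega> = L t \<omega>"
    using L_right by auto
  obtain U where U[measurable]: "(\<lambda>(t, \<omega>). U t \<omega>) \<in> borel_measurable (borel \<Otimes>\<^sub>M M)"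
    and U_eq: "\<forall>\<omega>. (\<forall>t\<in>{0..<T}. ((\<lambda>s. Y s \<omega>) \<longlongrightarrow> Y t \<omega>) (at_right t)) \<longrightarrow> (\<forall>t\<in>{0..T}. U t \<omega> = Y t \<omega>)"
    using right_continuous_jointly_measurable_version[of T Y M] \<open>0 < T\<close> Y_meas by blast
  have UY: "AE \<omega> in M. \<forall>t\<in>{0..T}. U t \<omega> = Y t \<omega>"
    using Y_cont
  proof eventually_elim
    case (elim \<omega>)
    show ?case by (intro U_eq[rule_format] ballI right_cont[OF elim])
  qed

  have y_eq: "net_process A L n p w t \<omega> = v t (Z \<omega>)" for t \<omega>
    by (simp add: net_process_def v_def Z_def)
  obtain y' where y_cont: "AE \<omega> in M. continuous_on {0..T} (\<lambda>t. v t (Z \<omega>))"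
    and y'_right: "AE \<omega> in M. \<forall>t\<in>{0..<T}. ((\<lambda>s. y' s \<omega>) \<longlongrightarrow> y' t \<omega>) (at_right t)"
    and y_der: "AE \<omega> in M. \<forall>t\<in>{0..<T}. ((\<lambda>s. v s (Z \<omega>)) has_vector_derivative y' t \<omega>) (at_right t)"
    using D1 by (auto simp: D1_def y_eq cadlag_on_def)
  have gy': "AE \<omega> in M. \<forall>t\<in>{0..<T}. g t (Z \<omega>) = y' t \<omega>"
    using y_der
  proof eventually_elim
    case (elim \<omega>)
    then show ?case
      unfolding g_def by (intro ballI right_derivative_eq_lim[where g = "\<lambda>s. v s (Z \<omega>)"]) blast
  qed

  have p_mem: "p i \<in> {0..T}" if "i \<in> {1..n}" for i
  proof -
    have "strict_mono_on {0..n} p" "p 0 = 0" "p n = T" using p by (auto simp: partition_of_def)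
    then show ?thesis
      using that strict_mono_onD[of "{0..n}" p 0 i] strict_mono_onD[of "{0..n}" p i n]
      by (cases "i = n") auto
  qed
  \<comment> \<open>Independence includes that \<open>G\<close> consists of events; this is the
    source of measurability for \<open>Lb\<close>.\<close>
  have GM: "sets G \<subseteq> sets M" using indep_setD_ev2[OF indep] by (simp add: G_def)
  have gen: "null_sets M \<union> (\<Union>s\<in>{0..T}. sets (vimage_algebra (space M) (L s) borel) \<union>
      sets (vimage_algebra (space M) (Lb s) borel)) \<subseteq> Pow (space M)"
    using sets.sets_into_space[of _ M] sets.sets_into_space[of _ "vimage_algebra (space M) (L _) borel"]
      sets.sets_into_space[of _ "vimage_algebra (space M) (Lb _) borel"] by fastforce
  have space_G: "space G = space M"
    unfolding G_def joint_sigma_def using gen by (rule space_measure_of)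
  have G_meas: "L s \<in> borel_measurable G" "Lb s \<in> borel_measurable G" if s: "s \<in> {0..T}" for s
  proof -
    have "h \<in> borel_measurable G" if "sets (vimage_algebra (space M) h borel) \<subseteq> sets G" for h :: "'a \<Rightarrow> real^'m"
      using that in_vimage_algebra[of _ borel h "space M"] space_G by (auto intro!: measurableI)
    moreover have "sets (vimage_algebra (space M) (L s) borel) \<subseteq> sets G"
      "sets (vimage_algebra (space M) (Lb s) borel) \<subseteq> sets G"
      unfolding G_def joint_sigma_def sets_measure_of[OF gen] using s by (auto intro!: sigma_sets.Basic)
    ultimately show "L s \<in> borel_measurable G" "Lb s \<in> borel_measurable G" by auto
  qed
  have Z_G: "Z \<in> measurable G S"
    unfolding Z_def S_def obs_def by (intro measurable_restrict G_meas p_mem)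
  have G_M: "h \<in> measurable M B" if "h \<in> measurable G B" for h and B :: "'c measure"
    using that GM space_G by (auto simp: measurable_def)
  have [measurable]: "Z \<in> measurable M S" by (rule G_M[OF Z_G])

  have v_meas[measurable]: "(\<lambda>(t, z). v t z) \<in> borel_measurable (borel \<Otimes>\<^sub>M S)"
    using borel_measurable_net_value[OF A, of w] by (simp add: v_def S_def case_prod_beta)
  have g_meas[measurable]: "(\<lambda>(t, z). g t z) \<in> borel_measurable (borel \<Otimes>\<^sub>M S)"
    unfolding g_def case_prod_beta by measurable
  have [measurable]: "(\<lambda>(t, y). b t y) \<in> borel_measurable (borel \<Otimes>\<^sub>M borel)"
    using borel_measurable_continuous_onI[OF a_cont] by (simp add: borel_prod case_prod_beta b_def)
  have [measurable]: "(\<lambda>u. \<sigma> *v u) \<in> borel_measurable borel"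
    by (intro borel_measurable_continuous_onI linear_continuous_on matrix_vector_mul_bounded_linear)

  define \<zeta> where "\<zeta> t \<omega> = v t (Z \<omega>) - U t \<omega>" for t \<omega>
  define \<delta> where "\<delta> t \<omega> = g t (Z \<omega>) - \<phi> t (U t \<omega>) (V t \<omega>)" for t \<omega>
  define \<rho> where "\<rho> t \<omega> = g t (Z \<omega>) - \<phi> t (v t (Z \<omega>)) (V t \<omega>)" for t \<omega>
  define k where "k t z u = ennreal ((norm (g t z - \<phi> t (v t z) u))\<^sup>2)" for t z u
  have meas[measurable]: "(\<lambda>(t, \<omega>). \<zeta> t \<omega>) \<in> borel_measurable (borel \<Otimes>\<^sub>M M)"
      "(\<lambda>(t, \<omega>). \<delta> t \<omega>) \<in> borel_measurable (borel \<Otimes>\<^sub>M M)"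
      "(\<lambda>(t, \<omega>). \<rho> t \<omega>) \<in> borel_measurable (borel \<Otimes>\<^sub>M M)"
    unfolding \<zeta>_def \<delta>_def \<rho>_def \<phi>_def by measurable
  have k_meas[measurable]: "(\<lambda>(t, z, u). k t z u) \<in> borel_measurable (borel \<Otimes>\<^sub>M S \<Otimes>\<^sub>M borel)"
    unfolding k_def \<phi>_def by measurable
  have [measurable]: "v 0 \<in> borel_measurable S"
    using measurable_Pair2[OF v_meas, of 0] by simp

  obtain X0 where X0: "(\<lambda>(t, \<omega>). X0 t \<omega>) \<in> borel_measurable (restrict_space borel {0..T} \<Otimes>\<^sub>M G)"
    and X0_eq: "AE \<omega> in M. \<forall>t\<in>{0..T}. Lb t \<omega> = X0 t \<omega>"
    using bridge by (auto simp: exact_levy_bridge_def G_def)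
  \<comment> \<open>The version granted by the bridge lives on [0,T] only; clipping extends it to
    all times.\<close>
  define X where "X t = X0 (c t)" for t
  have "c \<in> measurable borel (restrict_space borel {0..T})"
    unfolding c_def using \<open>0 < T\<close> by (intro measurable_restrict_space2) auto
  then have "(\<lambda>x. (c (fst x), snd x)) \<in> measurable (borel \<Otimes>\<^sub>M G) (restrict_space borel {0..T} \<Otimes>\<^sub>M G)"
    by measurable
  from measurable_compose[OF this X0]
  have X[measurable]: "(\<lambda>(t, \<omega>). X t \<omega>) \<in> borel_measurable (borel \<Otimes>\<^sub>M G)"
    by (simp add: X_def case_prod_beta)
  have X_eq: "AE \<omega> in M. \<forall>t\<in>{0..T}. Lb t \<omega> = X t \<omega>"
    using X0_eq by eventually_elim (auto simp: X_def c)
  have law: "distr M (S \<Otimes>\<^sub>M borel) (\<lambda>\<omega>. (Z \<omega>, X t \<omega>)) = distr M (S \<Otimes>\<^sub>M borel) (\<lambda>\<omega>. (Z \<omega>, V t \<omega>))"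
    if t: "t \<in> {0..T}" for t
  proof -
    have [measurable]: "X t \<in> borel_measurable M" "Lb t \<in> borel_measurable M"
      "L t \<in> borel_measurable M" "V t \<in> borel_measurable M"
      using measurable_Pair2[OF X, of t] measurable_Pair2[OF V, of t] G_meas[OF t] by (auto intro: G_M)
    have "distr M (S \<Otimes>\<^sub>M borel) (\<lambda>\<omega>. (Z \<omega>, X t \<omega>)) = distr M (S \<Otimes>\<^sub>M borel) (\<lambda>\<omega>. (Z \<omega>, Lb t \<omega>))"
      by (rule distr_cong_AE) (use X_eq t in \<open>auto elim!: eventually_mono\<close>)
    also have "\<dots> = distr M (S \<Otimes>\<^sub>M borel) (\<lambda>\<omega>. (Z \<omega>, L t \<omega>))"
    proof (rule distr_pair_eq_of_cond_exp_eq)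
      fix B :: "(real^'m) set" assume "B \<in> sets borel"
      then show "AE \<omega> in M.
          real_cond_exp M (vimage_algebra (space M) Z S) (\<lambda>\<omega>. indicator B (Lb t \<omega>)) \<omega> =
          real_cond_exp M (vimage_algebra (space M) Z S) (\<lambda>\<omega>. indicator B (L t \<omega>)) \<omega>"
        using bridge t unfolding exact_levy_bridge_def obs_sigma_def Z_def S_def by blast
    qed measurable
    also have "\<dots> = distr M (S \<Otimes>\<^sub>M borel) (\<lambda>\<omega>. (Z \<omega>, V t \<omega>))"
      by (rule distr_cong_AE) (use VL t in \<open>auto elim!: eventually_mono\<close>)
    finally show ?thesis .
  qed

  \<comment> \<open>Away from the end points the right derivative at \<open>\<tau>\<close> exists
    and the clipping has no effect.\<close>
  have \<tau>_mem: "AE \<omega> in M. \<tau> \<omega> \<in> {0<..<T}"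
  proof (rule AE_distrD[OF \<tau>])
    show "AE t in distr M borel \<tau>. t \<in> {0<..<T}"
      unfolding uniform by (rule AE_uniform_measureI) auto
  qed
  \<comment> \<open>Since \<open>Y\<close> starts at \<open>x0\<close>, the mismatch of the network
    at time 0 is the initial error \<open>\<zeta> 0\<close>.\<close>
  have "l = (\<integral>\<^sup>+\<omega>. ennreal ((norm (\<zeta> 0 \<omega>))\<^sup>2) + ennreal T * k (\<tau> \<omega>) (Z \<omega>) (X (\<tau> \<omega>) \<omega>) \<partial>M)"
    unfolding l_def loss_def
  proof (rule nn_integral_cong_AE)
    show "AE \<omega> in M. ennreal ((norm (net_value A w 0 (obs L n p \<omega>) - x0))\<^sup>2 +
         T * (norm (right_deriv (\<lambda>t. net_value A w t (obs L n p \<omega>)) (\<tau> \<omega>) -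
                    f_coeff a \<sigma> (\<tau> \<omega>) (net_value A w (\<tau> \<omega>) (obs L n p \<omega>)) (Lb (\<tau> \<omega>) \<omega>)))\<^sup>2) =
       ennreal ((norm (\<zeta> 0 \<omega>))\<^sup>2) + ennreal T * k (\<tau> \<omega>) (Z \<omega>) (X (\<tau> \<omega>) \<omega>)"
      using \<tau>_mem X_eq gy' y_der Y0 UY
    proof eventually_elim
      case (elim \<omega>)
      have "right_deriv (\<lambda>t. v t (Z \<omega>)) (\<tau> \<omega>) = y' (\<tau> \<omega>) \<omega>"
        unfolding right_deriv_def
        by (rule vector_derivative_within) (use elim in \<open>auto simp: trivial_limit_at_right_real\<close>)
      moreover have "Lb (\<tau> \<omega>) \<omega> = X (\<tau> \<omega>) \<omega>" "g (\<tau> \<omega>) (Z \<omega>) = y' (\<tau> \<omega>) \<omega>" "U 0 \<omega> = x0" "c (\<tau> \<omega>) = \<tau> \<omega>"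
        using elim \<open>0 < T\<close> by (auto intro: c(2))
      ultimately show ?case
        using \<open>0 < T\<close>
        by (simp add: v_def[symmetric] Z_def[symmetric] \<zeta>_def k_def \<phi>_def b_def f_coeff_def ennreal_mult)
    qed
  qed
  also have "\<dots> = (\<integral>\<^sup>+\<omega>. ennreal ((norm (\<zeta> 0 \<omega>))\<^sup>2) \<partial>M) + ennreal T * (\<integral>\<^sup>+\<omega>. k (\<tau> \<omega>) (Z \<omega>) (X (\<tau> \<omega>) \<omega>) \<partial>M)"
  proof -
    have "(\<lambda>x. (fst x, snd x)) \<in> measurable (borel \<Otimes>\<^sub>M M) (borel \<Otimes>\<^sub>M G)"
      by (intro measurable_Pair measurable_compose[OF measurable_snd] G_M) auto
    from measurable_compose[OF this X]
    have [measurable]: "(\<lambda>(t, \<omega>). X t \<omega>) \<in> borel_measurable (borel \<Otimes>\<^sub>M M)"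
      by (simp add: case_prod_beta)
    note [measurable] = \<tau>
    have "(\<lambda>\<omega>. (\<tau> \<omega>, Z \<omega>, X (\<tau> \<omega>) \<omega>)) \<in> measurable M (borel \<Otimes>\<^sub>M S \<Otimes>\<^sub>M borel)"
      by measurable
    from measurable_compose[OF this k_meas]
    have [measurable]: "(\<lambda>\<omega>. k (\<tau> \<omega>) (Z \<omega>) (X (\<tau> \<omega>) \<omega>)) \<in> borel_measurable M" by simp
    have [measurable]: "\<zeta> 0 \<in> borel_measurable M"
      using measurable_Pair2[OF meas(1), of 0] by simp
    show ?thesis by (simp add: nn_integral_add nn_integral_cmult)
  qed
  also have "ennreal T * (\<integral>\<^sup>+\<omega>. k (\<tau> \<omega>) (Z \<omega>) (X (\<tau> \<omega>) \<omega>) \<partial>M) =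
      (\<integral>\<^sup>+\<omega>. (\<integral>\<^sup>+t\<in>{0..T}. k t (Z \<omega>) (V t \<omega>) \<partial>lborel) \<partial>M)"
    by (rule nn_integral_random_time_residual[OF \<open>0 < T\<close> \<tau> uniform space_G _ Z_G X V k_meas law])
       (use indep in \<open>simp_all add: G_def\<close>)
  also have "\<dots> = (\<integral>\<^sup>+\<omega>. (\<integral>\<^sup>+t\<in>{0..T}. ennreal ((norm (\<rho> t \<omega>))\<^sup>2) \<partial>lborel) \<partial>M)"
    by (simp add: k_def \<rho>_def)
  also have "(\<integral>\<^sup>+\<omega>. ennreal ((norm (\<zeta> 0 \<omega>))\<^sup>2) \<partial>M) + \<dots> =
      (\<integral>\<^sup>+\<omega>. ennreal ((norm (\<zeta> 0 \<omega>))\<^sup>2) + (\<integral>\<^sup>+t\<in>{0..T}. ennreal ((norm (\<rho> t \<omega>))\<^sup>2) \<partial>lborel) \<partial>M)"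
  proof -
    have [measurable]: "\<zeta> 0 \<in> borel_measurable M"
      using measurable_Pair2[OF meas(1), of 0] by simp
    show ?thesis by (rule nn_integral_add[symmetric]) measurable
  qed
  finally have l: "l = (\<integral>\<^sup>+\<omega>. ennreal ((norm (\<zeta> 0 \<omega>))\<^sup>2) +
      (\<integral>\<^sup>+t\<in>{0..T}. ennreal ((norm (\<rho> t \<omega>))\<^sup>2) \<partial>lborel) \<partial>M)" .

  have z_cont: "AE \<omega> in M. continuous_on {0..T} (\<lambda>t. v t (Z \<omega>) - Y t \<omega>)"
    using y_cont Y_cont by eventually_elim (rule continuous_on_diff)
  have z_eq: "AE \<omega> in M. \<forall>t\<in>{0..T}. v t (Z \<omega>) - Y t \<omega> = \<zeta> t \<omega>"
    using UY by eventually_elim (simp add: \<zeta>_def)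
  have z_der: "AE \<omega> in M. \<forall>t\<in>{0..<T}. ((\<lambda>s. v s (Z \<omega>) - Y s \<omega>) has_vector_derivative \<delta> t \<omega>) (at_right t)"
    using y_der Y_der gy' UY VL
    by eventually_elim (auto simp: \<delta>_def intro!: has_vector_derivative_diff)
  \<comment> \<open>The network derivative cancels in \<open>\<delta> - \<rho>\<close>. What remains
    compares the coefficient at \<open>v\<close> and at \<open>U\<close> for the same noise, where
    it is Lipschitz.\<close>
  have z_bound: "AE \<omega> in M. \<forall>t\<in>{0..<T}. norm (\<delta> t \<omega> - \<rho> t \<omega>) \<le> La * norm (v t (Z \<omega>) - Y t \<omega>)"
    using UY
  proof eventually_elim
    case (elim \<omega>)
    show ?case
    proof
      fix t assume "t \<in> {0..<T}"
      then show "norm (\<delta> t \<omega> - \<rho> t \<omega>) \<le> La * norm (v t (Z \<omega>) - Y t \<omega>)"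
        using lip[of t "v t (Z \<omega>)" "V t \<omega>" "U t \<omega>"] elim by (simp add: \<delta>_def \<rho>_def)
    qed
  qed
  \<comment> \<open>\<open>g\<close> and \<open>V\<close> are measurable stand-ins without
    regularity of their own. The limit is computed for \<open>y'\<close> and \<open>L\<close>, and
    carried over because they agree near \<open>t\<close> inside [0,T).\<close>
  have \<rho>_right: "AE \<omega> in M. \<forall>t\<in>{0..<T}. ((\<lambda>s. \<rho> s \<omega>) \<longlongrightarrow> \<rho> t \<omega>) (at_right t)"
    using y_cont y'_right gy' VL L_right
  proof eventually_elim
    case (elim \<omega>)
    have \<rho>: "\<rho> s \<omega> = y' s \<omega> - \<phi> s (v s (Z \<omega>)) (L s \<omega>)" if "s \<in> {0..<T}" for s
      using elim that by (simp add: \<rho>_def)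
    show ?case
    proof
      fix t assume t: "t \<in> {0..<T}"
      show "((\<lambda>s. \<rho> s \<omega>) \<longlongrightarrow> \<rho> t \<omega>) (at_right t)"
        unfolding \<rho>[OF t]
      proof (rule Lim_transform_eventually)
        show "((\<lambda>s. y' s \<omega> - \<phi> s (v s (Z \<omega>)) (L s \<omega>)) \<longlongrightarrow> y' t \<omega> - \<phi> t (v t (Z \<omega>)) (L t \<omega>)) (at_right t)"
          using elim t right_cont[OF elim(1) t] by (intro tendsto_diff \<phi>_tendsto) blast+
        have "eventually (\<lambda>s. s \<in> {t<..<T}) (at_right t)"
          using t by (intro eventually_at_right_real) auto
        then show "eventually (\<lambda>s. y' s \<omega> - \<phi> s (v s (Z \<omega>)) (L s \<omega>) = \<rho> s \<omega>) (at_right t)"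
          by eventually_elim (use t \<rho> in auto)
      qed
    qed
  qed
  note bounds = norm1_residual_equivalence[OF M \<open>0 < T\<close> A2(1) meas z_cont z_eq z_der z_bound \<rho>_right]
  show "e \<le> ennreal (sqrt E + sqrt (2 * La\<^sup>2 * T * E + 2)) * ennreal_sqrt l"
    using bounds(1) unfolding e_def E_def l y_eq .
  show "ennreal_sqrt l \<le> ennreal (sqrt (1 + 2 * La\<^sup>2 * T) + sqrt 2) * e"
    using bounds(2) unfolding e_def l y_eq .
qed

theorem theorem1:
  fixes M :: "'a measure" and F :: "real \<Rightarrow> 'a measure"
    and T La :: real and x0 :: "real^'d" and \<sigma> :: "real^'m^'d"
    and a :: "real \<Rightarrow> real^'d \<Rightarrow> real^'d"
    and L :: "real \<Rightarrow> 'a \<Rightarrow> real^'m" and Y :: "real \<Rightarrow> 'a \<Rightarrow> real^'d"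
    and p :: "nat \<Rightarrow> nat \<Rightarrow> real"
    and N :: "nat \<Rightarrow> nat" and net :: "nat \<Rightarrow> ('d, 'm) ffnn"
    and \<tau> :: "'a \<Rightarrow> real" and Lb :: "nat \<Rightarrow> real \<Rightarrow> 'a \<Rightarrow> real^'m"
  assumes "T > 0"
    and "prob_space M" and "complete_measure M" and "usual_filtration M F"
    and "levy_process M F T L"
    and A1: "continuous_on ({0..T} \<times> UNIV) (\<lambda>(t, y). a t y)"
    and A2: "La \<ge> 0" "\<forall>t\<in>{0..T}. \<forall>y1 y2. norm (a t y1 - a t y2) \<le> La * norm (y1 - y2)"
    and "random_ode_solution M F T a \<sigma> x0 L Y"
    and "\<forall>n\<ge>1. partition_of T n (p n)"
    and "\<forall>n\<ge>1. feedforward n (N n) (net n)"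
    and "\<forall>n\<ge>1. \<forall>w\<in>{..<N n} \<rightarrow>\<^sub>E UNIV. net_process (net n) L n (p n) w \<in> D1 M F T"
    and "\<tau> \<in> borel_measurable M" and "distr M borel \<tau> = uniform_measure lborel {0<..<T}"
    and "prob_space.indep_set M (sets (vimage_algebra (space M) \<tau> borel)) (sets (F_infinity M F))"
    and "\<forall>n\<ge>1. exact_levy_bridge M T L n (p n) (Lb n)"
    and "\<forall>n\<ge>1. prob_space.indep_set M (sets (vimage_algebra (space M) \<tau> borel))
                  (sets (joint_sigma M T L (Lb n)))"
  shows "\<exists>\<gamma>::real. \<gamma> > 0 \<and>
    (\<forall>n\<ge>1. \<forall>w\<in>{..<N n} \<rightarrow>\<^sub>E UNIV.
       norm1 M T (\<lambda>t \<omega>. net_process (net n) L n (p n) w t \<omega> - Y t \<omega>)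
         \<le> ennreal \<gamma> *
            ((INF v\<in>{..<N n} \<rightarrow>\<^sub>E UNIV.
                norm1 M T (\<lambda>t \<omega>. net_process (net n) L n (p n) v t \<omega> - Y t \<omega>)) +
             ennreal_sqrt (loss M T a \<sigma> x0 L (Lb n) \<tau> (net n) n (p n) w -
               (INF v\<in>{..<N n} \<rightarrow>\<^sub>E UNIV. loss M T a \<sigma> x0 L (Lb n) \<tau> (net n) n (p n) v)))
     \<and> (is_arg_min (loss M T a \<sigma> x0 L (Lb n) \<tau> (net n) n (p n)) (\<lambda>v. v \<in> {..<N n} \<rightarrow>\<^sub>E UNIV) w \<longrightarrow>
          norm1 M T (\<lambda>t \<omega>. net_process (net n) L n (p n) w t \<omega> - Y t \<omega>)
            \<le> ennreal \<gamma> *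
               (INF v\<in>{..<N n} \<rightarrow>\<^sub>E UNIV.
                  norm1 M T (\<lambda>t \<omega>. net_process (net n) L n (p n) v t \<omega> - Y t \<omega>))))"
proof -
  \<comment> \<open>The constants are fixed before \<open>n\<close> and the weights appear, which
    makes \<open>\<gamma>\<close> uniform in both.\<close>
  define E where "E = exp ((2 * La + 1) * T)"
  define C where "C = sqrt E + sqrt (2 * La\<^sup>2 * T * E + 2)"
  define D where "D = sqrt (1 + 2 * La\<^sup>2 * T) + sqrt 2"
  have "0 < C"
    using \<open>T > 0\<close> unfolding C_def by (intro add_pos_nonneg real_sqrt_gt_zero) (auto simp: E_def)
  have "0 < D"
    using \<open>T > 0\<close> unfolding D_def by (intro add_nonneg_pos real_sqrt_ge_zero) auto
  have bounds:
    "norm1 M T (\<lambda>t \<omega>. net_process (net n) L n (p n) v t \<omega> - Y t \<omega>)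
      \<le> ennreal C * ennreal_sqrt (loss M T a \<sigma> x0 L (Lb n) \<tau> (net n) n (p n) v)"
    "ennreal_sqrt (loss M T a \<sigma> x0 L (Lb n) \<tau> (net n) n (p n) v)
      \<le> ennreal D * norm1 M T (\<lambda>t \<omega>. net_process (net n) L n (p n) v t \<omega> - Y t \<omega>)"
    if n: "n \<ge> 1" and v: "v \<in> {..<N n} \<rightarrow>\<^sub>E UNIV" for n v
    unfolding C_def D_def E_def
    by (rule network_loss_equivalence[OF assms(1,2,4-9) _ _ _ assms(13,14)]; use n v assms in blast)+
  show ?thesis
  proof (intro exI conjI allI impI ballI)
    show "0 < C * (1 + D)" using \<open>0 < C\<close> \<open>0 < D\<close> by simp
  qed (intro quasi_optimality[OF less_imp_le[OF \<open>0 < C\<close>] \<open>0 < D\<close> bounds]; assumption)+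
qed

end
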